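(* As $n\to\infty$, $$\sum_{j=1}^{2^n}\left(\xi_{j,n}-\frac{j}{2^n}\right)^2=2^n\int_0^1(?(x)-x)^2\,\mathrm{d}x+O\left(n^{-3/2}(\log n)^{-1/2}\right),$$ where $0=\xi_{0,n}<\xi_{1,n}<\dots<\xi_{2^n,n}=1$ are the elements of the $n$-th Stern-Brocot sequence $F_n$ in increasing order and $?(x)$ is the Minkowski question mark function.
   Context: Stern-Brocot sequences: $F_0=\{0/1,1/1\}$. If $F_n$ is written in increasing order as $0=\xi_{0,n}<\xi_{1,n}<\dots<\xi_{2^n,n}=1$ with $\xi_{j,n}=p_{j,n}/q_{j,n}$ in lowest terms, then $F_{n+1}=F_n\cup W_{n+1}$, where $W_{n+1}=\left\{\frac{p_{j,n}+p_{j+1,n}}{q_{j,n}+q_{j+1,n}}: j=0,\dots,2^n-1\right\}$. Thus $|F_n|=2^n+1$. Minkowski question mark function: for $x\in[0,1]$, $?(x)=\lim_{n\to\infty}\frac{|F_n\cap[0,x)|}{2^n+1}$. It is a continuous strictly increasing function from $[0,1]$ onto $[0,1]$. Equivalently, if $x=[0;a_1,a_2,\dots]$ is the continued fraction expansion of $x$, then $?(x)=2\sum_{n\ge1}(-1)^{n-1}2^{-(a_1+\dots+a_n)}$ (a finite sum if $x$ is rational). *)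

theory Defs
  imports "HOL-Analysis.Analysis" "HOL-Library.Landau_Symbols"
begin

text \<open>\<open>quotient_of\<close> yields the representation in lowest terms with positive denominator.\<close>

definition mediant :: "rat \<Rightarrow> rat \<Rightarrow> rat" where
  "mediant r s =
     Fract (fst (quotient_of r) + fst (quotient_of s)) (snd (quotient_of r) + snd (quotient_of s))"

primrec stern_brocot :: "nat \<Rightarrow> rat set" where
  "stern_brocot 0 = {0, 1}"
| "stern_brocot (Suc n) = stern_brocot n \<union>
     (let xs = sorted_list_of_set (stern_brocot n)
      in (\<lambda>j. mediant (xs ! j) (xs ! Suc j)) ` {..<2 ^ n})"

text \<open>The elements of \<open>stern_brocot n\<close> in increasing order, with indices \<open>0, \<dots>, 2 ^ n\<close>.\<close>

definition sb_elem :: "nat \<Rightarrow> nat \<Rightarrow> rat" where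
  "sb_elem n j = sorted_list_of_set (stern_brocot n) ! j"

definition question_mark :: "real \<Rightarrow> real" where
  "question_mark x =
     lim (\<lambda>n. real (card (real_of_rat ` stern_brocot n \<inter> {0..<x})) / (2 ^ n + 1))"

end

theory Submission
  imports Defs
begin

text \<open>Write \<open>\<xi>\<^sub>j\<close> for the elements of \<open>F\<^sub>n\<close>, \<open>N = 2\<^sup>n\<close>, \<open>D\<^sub>n\<close> for the sum of squares, \<open>I\<close> for
  the integral and \<open>E\<^sub>n = D\<^sub>n - N I\<close>. The proof shows the stronger estimate \<open>E\<^sub>n =
  O(n\<^sup>-\<^sup>2)\<close>; it dominates the required one because \<open>ln n \<le> n\<close>.

  Since \<open>?\<close> stays between \<open>j/N\<close> and \<open>(j+1)/N\<close> on \<open>[\<xi>\<^sub>j, \<xi>\<^sub>j\<^sub>+\<^sub>1]\<close>, replacing it by \<open>j/N\<close>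
  turns \<open>I\<close> into a sum of differences of cubes, which telescopes to \<open>D\<^sub>n/N\<close> up to
  \<open>O(1/N)\<close>. Hence \<open>E\<^sub>n\<close> is bounded (\<open>deviation_integral_bounded\<close>). A bounded sequence with
  \<open>|E\<^sub>n\<^sub>+\<^sub>1 - 2 E\<^sub>n| \<le> r\<^sub>n\<close> and \<open>r\<close> decreasing satisfies \<open>|E\<^sub>n| \<le> r\<^sub>n\<close>
  (\<open>bounded_doubling_recurrence\<close>), and \<open>E\<^sub>n\<^sub>+\<^sub>1 - 2 E\<^sub>n = D\<^sub>n\<^sub>+\<^sub>1 - 2 D\<^sub>n\<close> no longer
  involves the integral. So everything reduces to \<open>D\<^sub>n\<^sub>+\<^sub>1 - 2 D\<^sub>n = O(n\<^sup>-\<^sup>2)\<close>.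

  For a function \<open>F\<close> let \<open>c\<^sub>j(F) = 2 F(\<eta>\<^sub>j) - F(\<xi>\<^sub>j) - F(\<xi>\<^sub>j\<^sub>+\<^sub>1)\<close>, where \<open>\<eta>\<^sub>j\<close> is the
  mediant of \<open>\<xi>\<^sub>j\<close> and \<open>\<xi>\<^sub>j\<^sub>+\<^sub>1\<close>. Expanding squares gives \<open>2 (D\<^sub>n\<^sub>+\<^sub>1 - 2 D\<^sub>n) = \<Sum>
  c\<^sub>j(x\<^sup>2) - 2 \<Sum> (j/N) c\<^sub>j(x) + O(1/N)\<close>. The first sum is \<open>-2/(n+2) + O(n\<^sup>-\<^sup>2)\<close>, the
  second \<open>-1/(n+2) + O(n\<^sup>-\<^sup>2)\<close>, so the terms of order \<open>1/n\<close> cancel.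

  Both expansions come from the self-similarity of the array: level \<open>n+1\<close> consists of the
  images of level \<open>n\<close> under \<open>x \<mapsto> x/(1+x)\<close> and \<open>x \<mapsto> 1/(2-x)\<close>. With the transfer operator \<open>L
  F = F(x/(1+x)) + F(1/(2-x))\<close> one gets \<open>\<Sum> c\<^sub>j(F) = 2 (L\<^sup>nF)(1/2) - (L\<^sup>nF)(0) -
  (L\<^sup>nF)(1)\<close>. The branches have the neutral fixed points \<open>0\<close> and \<open>1\<close>; following the orbits
  that stay there produces the main term \<open>F(1/(n+2)) + F(1 - 1/(n+2)) - F(0) - F(1)\<close>, and
  every departure from a fixed point contributes a symmetric second difference of some
  \<open>L\<^sup>mF\<close> about \<open>1/2\<close> with step about \<open>1/(4k)\<close>, where \<open>k + m = n + 1\<close>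
  (\<open>endpoint_gain_transfer_pow\<close>). These must be shown to be \<open>O(k\<^sup>-\<^sup>2 (m+1)\<^sup>-\<^sup>2)\<close>.

  Two monotonicity principles do this without any spectral theory. First, \<open>L\<close> preserves
  concavity of functions symmetric about \<open>1/2\<close>, so the second differences are monotone in
  \<open>F\<close> for the order in which concave functions are positive (\<open>bend_transfer_pow_nonneg\<close>).
  It therefore suffices to treat one strongly concave reference function, \<open>x/(1+x)\<close>.
  Secondly, this function belongs to the family \<open>F\<^sub>a\<^sub>b\<close> of Moebius maps, which satisfies
  \<open>L F\<^sub>a\<^sub>b = F\<^sub>a\<^sub>,\<^sub>a\<^sub>+\<^sub>b + F\<^sub>a\<^sub>+\<^sub>b\<^sub>,\<^sub>b + const\<close>. For \<open>a = x\<close> and \<open>b = 1 - x\<close> the second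
  difference of \<open>L\<^sup>mF\<^sub>a\<^sub>b\<close>, as a function of \<open>x\<close>, is non-negative and decreasing on \<open>(0,
  1/2]\<close> for every \<open>m\<close>; the two terms of the recursion then have opposite signs, and
  dropping the negative one gives the bound \<open>C w\<^sup>2/(1 + m x)\<^sup>2\<close> for step \<open>w\<close>
  (\<open>mob_bend_profile_decay\<close>).

  The sum weighted by \<open>j/N\<close> obeys, on the Moebius family, a recursion in \<open>(a, b)\<close> in which
  the binary digit of \<open>j/N\<close> produces an unweighted sum as inhomogeneous term. It is solved
  by induction with a weight function on pairs \<open>(a, b)\<close> whose sum over the two children
  grows by less than a factor \<open>2\<close> (\<open>tree_moment_mob\<close>).\<close>

section \<open>The Stern-Brocot array\<close>

text \<open>Numerators and denominators of level \<open>n+1\<close>, read off from level \<open>n\<close> by the two halves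
  instead of by inserting mediants: the left half is \<open>p/q \<mapsto> p/(p+q)\<close>, the right half \<open>p/q
  \<mapsto> q/(2q-p)\<close>. Both halves agree at the common index \<open>2\<^sup>n\<close>. This form makes the
  self-similarity definitional; the mediant rule is derived from it in \<open>sb_odd\<close>.\<close>

fun sb_num sb_den :: "nat \<Rightarrow> nat \<Rightarrow> int" where
  "sb_num 0 j = int j"
| "sb_num (Suc n) j = (if j \<le> 2 ^ n then sb_num n j else sb_den n (j - 2 ^ n))"
| "sb_den 0 j = 1"
| "sb_den (Suc n) j = (if j \<le> 2 ^ n then sb_num n j + sb_den n j
     else 2 * sb_den n (j - 2 ^ n) - sb_num n (j - 2 ^ n))"

lemma sb_first: "sb_num n 0 = 0" "sb_den n 0 = 1"
  by (induction n) auto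

lemma sb_last: "sb_num n (2 ^ n) = 1" "sb_den n (2 ^ n) = 1"
  by (induction n) (auto simp: sb_first)

lemma sb_left:
  assumes "j \<le> 2 ^ n"
  shows "sb_num (Suc n) j = sb_num n j" "sb_den (Suc n) j = sb_num n j + sb_den n j"
  using assms by auto

lemma sb_right:
  "sb_num (Suc n) (2 ^ n + j) = sb_den n j"
  "sb_den (Suc n) (2 ^ n + j) = 2 * sb_den n j - sb_num n j"
  by (auto simp: sb_first sb_last)

declare sb_num.simps(2) [simp del] sb_den.simps(2) [simp del]

lemma index_cases:
  fixes j :: nat
  assumes "j \<le> 2 ^ Suc n"
  obtains (left) "j \<le> 2 ^ n" | (right) i where "j = 2 ^ n + i" "i \<le> 2 ^ n"
proof (cases "j \<le> 2 ^ n")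
  case False
  then show ?thesis using assms right[of "j - 2 ^ n"] by auto
qed (rule left)

lemma strict_index_cases:
  fixes j :: nat
  assumes "j < 2 ^ Suc n"
  obtains (left) "j < 2 ^ n" | (right) i where "j = 2 ^ n + i" "i < 2 ^ n"
proof (cases "j < 2 ^ n")
  case False
  then show ?thesis using assms right[of "j - 2 ^ n"] by auto
qed (rule left)

lemma sb_bounds:
  "j \<le> 2 ^ n \<Longrightarrow> 0 \<le> sb_num n j \<and> sb_num n j \<le> sb_den n j \<and> 0 < sb_den n j"
proof (induction n arbitrary: j)
  case 0
  then show ?case by auto
next
  case (Suc n)
  from Suc.prems show ?case
  proof (cases rule: index_cases)
    case left
    with Suc.IH[of j] show ?thesis by (auto simp: sb_left)
  next
    case (right i)
    with Suc.IH[of i] show ?thesis by (auto simp: sb_right)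
  qed
qed

lemma sb_even:
  "j \<le> 2 ^ n \<Longrightarrow> sb_num (Suc n) (2 * j) = sb_num n j \<and> sb_den (Suc n) (2 * j) = sb_den n j"
proof (induction n arbitrary: j)
  case 0
  then have "j = 0 \<or> j = 1" by auto
  then show ?case using sb_last[of 1] by (auto simp: sb_first)
next
  case (Suc n)
  from Suc.prems show ?case
  proof (cases rule: index_cases)
    case left
    with Suc.IH[of j] show ?thesis by (auto simp: sb_left)
  next
    case (right i)
    have "2 * j = 2 ^ Suc n + 2 * i" using right by simp
    with right Suc.IH[of i] show ?thesis by (simp only: sb_right)
  qed
qed

text \<open>Both half maps act linearly on the pair of numerator and denominator, so they commute
  with taking mediants.\<close>

lemma sb_odd:
  "j < 2 ^ n \<Longrightarrow> sb_num (Suc n) (Suc (2 * j)) = sb_num n j + sb_num n (Suc j) \<and>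
     sb_den (Suc n) (Suc (2 * j)) = sb_den n j + sb_den n (Suc j)"
proof (induction n arbitrary: j)
  case 0
  then show ?case by (auto simp: sb_left)
next
  case (Suc n)
  from Suc.prems show ?case
  proof (cases rule: strict_index_cases)
    case left
    with Suc.IH[of j] show ?thesis by (auto simp: sb_left)
  next
    case (right i)
    have e: "Suc (2 * j) = 2 ^ Suc n + Suc (2 * i)" "Suc j = 2 ^ n + Suc i" using right by auto
    show ?thesis unfolding e unfolding right(1) sb_right using right Suc.IH[of i] by simp
  qed
qed

text \<open>Both half maps have determinant \<open>1\<close>. This relation yields lowest terms and the order of
  the elements.\<close>

lemma sb_unimodular:
  "j < 2 ^ n \<Longrightarrow> sb_num n (Suc j) * sb_den n j - sb_num n j * sb_den n (Suc j) = 1"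
proof (induction n arbitrary: j)
  case 0
  then show ?case by auto
next
  case (Suc n)
  from Suc.prems show ?case
  proof (cases rule: strict_index_cases)
    case left
    with Suc.IH[of j] show ?thesis by (auto simp: sb_left algebra_simps)
  next
    case (right i)
    have e: "Suc j = 2 ^ n + Suc i" using right by auto
    show ?thesis unfolding e unfolding right(1) sb_right using right Suc.IH[of i] by (simp add: algebra_simps)
  qed
qed

lemma sb_coprime:
  assumes "j \<le> 2 ^ n" shows "coprime (sb_num n j) (sb_den n j)"
proof (cases "j = 2 ^ n")
  case True
  then show ?thesis by (simp add: sb_last)
next
  case False
  with assms have "sb_num n (Suc j) * sb_den n j - sb_num n j * sb_den n (Suc j) = 1"
    by (intro sb_unimodular) simp
  then show ?thesis
    by (intro coprimeI) (metis dvd_diff dvd_mult dvd_mult2)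
qed

definition sb_rat :: "nat \<Rightarrow> nat \<Rightarrow> rat" where
  "sb_rat n j = Fract (sb_num n j) (sb_den n j)"

lemma quotient_of_sb_rat: "j \<le> 2 ^ n \<Longrightarrow> quotient_of (sb_rat n j) = (sb_num n j, sb_den n j)"
  using sb_coprime[of j n] sb_bounds[of j n] by (auto simp: sb_rat_def quotient_of_Fract)

lemma sb_rat_even: "j \<le> 2 ^ n \<Longrightarrow> sb_rat (Suc n) (2 * j) = sb_rat n j"
  by (simp add: sb_rat_def sb_even)

text \<open>The fractions are in lowest terms, so the pairs above are exactly the ones that
  \<open>mediant\<close> adds.\<close>

lemma sb_rat_odd: "j < 2 ^ n \<Longrightarrow> sb_rat (Suc n) (Suc (2 * j)) = mediant (sb_rat n j) (sb_rat n (Suc j))"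
  by (simp add: mediant_def quotient_of_sb_rat) (simp add: sb_rat_def sb_odd)

lemma sb_rat_less_Suc:
  assumes "j < 2 ^ n" shows "sb_rat n j < sb_rat n (Suc j)"
  using sb_unimodular[OF assms] sb_bounds[of j n] sb_bounds[of "Suc j" n] assms
  unfolding sb_rat_def by (auto simp: mult.commute)

lemma sb_rat_strict_mono: "i < j \<Longrightarrow> j \<le> 2 ^ n \<Longrightarrow> sb_rat n i < sb_rat n j"
proof (induction j)
  case (Suc j)
  with sb_rat_less_Suc[of j n] show ?case by (cases "i = j") auto
qed simp

lemma nat_upto_double: "{..2 * m} = (\<lambda>j. 2 * j) ` {..m} \<union> (\<lambda>j. Suc (2 * j)) ` {..<m::nat}"
  (is "?A = ?B")
proof
  show "?A \<subseteq> ?B"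
  proof
    fix k assume "k \<in> ?A"
    then show "k \<in> ?B"
      by (cases "even k") (auto elim!: evenE oddE)
  qed
qed auto

text \<open>The indexing of the array is increasing, hence it is the sorted enumeration used in the
  definition of the sequences.\<close>

lemma sorted_list_sb_rat:
  "sorted_list_of_set (sb_rat n ` {..2 ^ n}) = map (sb_rat n) [0..<Suc (2 ^ n)]"
proof -
  have s: "sorted_wrt (<) (map (sb_rat n) [0..<Suc (2 ^ n)])"
    by (auto simp: sorted_wrt_iff_nth_less sb_rat_strict_mono simp del: upt_Suc)
  have e: "sb_rat n ` {..2 ^ n} = set (map (sb_rat n) [0..<Suc (2 ^ n)])" by (simp only: set_map atLeast_upt[symmetric] lessThan_Suc_atMost)
  show ?thesis unfolding e using s strict_sorted_iff
    by (metis sorted_list_of_set.idem_if_sorted_distinct)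
qed

lemma stern_brocot_eq: "stern_brocot n = sb_rat n ` {..2 ^ n}"
proof (induction n)
  case 0
  have "{..2 ^ 0} = {0, 1::nat}" by auto
  then show ?case by (simp add: sb_rat_def Zero_rat_def One_rat_def)
next
  case (Suc n)
  have *: "(map (sb_rat n) [0..<Suc (2 ^ n)]) ! j = sb_rat n j" if "j \<le> 2 ^ n" for j
    using that by (subst nth_map) (auto simp del: upt_Suc)
  have "{..2 ^ Suc n} = (\<lambda>j. 2 * j) ` {..2 ^ n} \<union> (\<lambda>j. Suc (2 * j)) ` {..<2 ^ n::nat}"
    using nat_upto_double[of "2 ^ n"] by simp
  then have "sb_rat (Suc n) ` {..2 ^ Suc n} = sb_rat n ` {..2 ^ n} \<union>
      (\<lambda>j. mediant (sb_rat n j) (sb_rat n (Suc j))) ` {..<2 ^ n}"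
    by (simp add: image_Un image_image sb_rat_even sb_rat_odd cong: image_cong_simp)
  moreover have "(\<lambda>j. mediant (sb_rat n j) (sb_rat n (Suc j))) ` {..<2 ^ n} =
     (let xs = sorted_list_of_set (stern_brocot n)
      in (\<lambda>j. mediant (xs ! j) (xs ! Suc j)) ` {..<2 ^ n})"
    unfolding Suc.IH sorted_list_sb_rat Let_def by (intro image_cong) (auto simp: * simp del: upt_Suc)
  ultimately show ?case using Suc.IH by simp
qed

lemma sb_elem_eq: "j \<le> 2 ^ n \<Longrightarrow> sb_elem n j = sb_rat n j"
  unfolding sb_elem_def stern_brocot_eq sorted_list_sb_rat
  by (subst nth_map) (auto simp del: upt_Suc)

definition sb_pt :: "nat \<Rightarrow> nat \<Rightarrow> real" where
  "sb_pt n j = real_of_int (sb_num n j) / real_of_int (sb_den n j)"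

lemma of_rat_sb_rat: "j \<le> 2 ^ n \<Longrightarrow> real_of_rat (sb_rat n j) = sb_pt n j"
  using sb_bounds[of j n] by (auto simp: sb_rat_def sb_pt_def of_rat_rat)

lemma sb_pt_strict_mono: "i < j \<Longrightarrow> j \<le> 2 ^ n \<Longrightarrow> sb_pt n i < sb_pt n j"
  using sb_rat_strict_mono[of i j n] by (simp add: of_rat_sb_rat[symmetric] of_rat_less)

lemma sb_pt_first: "sb_pt n 0 = 0" and sb_pt_last: "sb_pt n (2 ^ n) = 1"
  by (simp_all add: sb_pt_def sb_first sb_last)

lemma sb_pt_bounds: "j \<le> 2 ^ n \<Longrightarrow> sb_pt n j \<in> {0..1}"
  using sb_bounds[of j n] by (auto simp: sb_pt_def)

lemma sb_pt_even: "j \<le> 2 ^ n \<Longrightarrow> sb_pt (Suc n) (2 * j) = sb_pt n j"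
  by (simp add: sb_pt_def sb_even)


definition sb_lo :: "real \<Rightarrow> real" where
  "sb_lo x = x / (1 + x)"

definition sb_hi :: "real \<Rightarrow> real" where
  "sb_hi x = 1 / (2 - x)"

lemma sb_pt_lower: "j \<le> 2 ^ n \<Longrightarrow> sb_pt (Suc n) j = sb_lo (sb_pt n j)"
  using sb_bounds[of j n] by (auto simp: sb_pt_def sb_left sb_lo_def field_simps)

lemma sb_pt_upper: "j \<le> 2 ^ n \<Longrightarrow> sb_pt (Suc n) (2 ^ n + j) = sb_hi (sb_pt n j)"
  using sb_bounds[of j n] unfolding sb_pt_def sb_right sb_hi_def by (auto simp: field_simps)

section \<open>The transfer operator\<close>

lemma sb_branch_range:
  assumes "x \<in> {0..1}" shows "sb_lo x \<in> {0..1/2}" "sb_hi x \<in> {1/2..1}"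
  using assms by (auto simp: sb_lo_def sb_hi_def field_simps)

lemma sb_branch_unit: "x \<in> {0..1} \<Longrightarrow> sb_lo x \<in> {0..1}" "x \<in> {0..1} \<Longrightarrow> sb_hi x \<in> {0..1}"
  using sb_branch_range[of x] by auto

lemma sb_branch_reflect:
  assumes "x \<in> {0..1}" shows "sb_lo (1 - x) = 1 - sb_hi x" "sb_hi (1 - x) = 1 - sb_lo x"
  using assms by (auto simp: sb_lo_def sb_hi_def field_simps)

text \<open>The transfer operator of the Farey-type map with inverse branches \<open>sb_lo\<close> and \<open>sb_hi\<close>,
  acting on primitives of densities (so without the Jacobian factors). Constants are
  irrelevant for all functionals below, which is why no normalisation is made.\<close>

definition transfer :: "(real \<Rightarrow> real) \<Rightarrow> real \<Rightarrow> real" where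
  "transfer F x = F (sb_lo x) + F (sb_hi x)"

abbreviation transfer_pow :: "nat \<Rightarrow> (real \<Rightarrow> real) \<Rightarrow> real \<Rightarrow> real" where
  "transfer_pow m \<equiv> transfer ^^ m"

lemma transfer_pow_Suc: "transfer_pow (Suc m) F = transfer_pow m (transfer F)"
  by (simp add: funpow_swap1)

lemma transfer_pow_cong:
  assumes "\<And>x. x \<in> {0..1} \<Longrightarrow> F x = G x"
  shows "x \<in> {0..1} \<Longrightarrow> transfer_pow m F x = transfer_pow m G x"
  using assms by (induction m arbitrary: x) (auto simp: transfer_def sb_branch_unit simp del: atLeastAtMost_iff)

lemma transfer_pow_add: "transfer_pow m (\<lambda>x. F x + G x) = (\<lambda>x. transfer_pow m F x + transfer_pow m G x)"
  by (induction m) (auto simp: transfer_def)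

lemma transfer_pow_cmult: "transfer_pow m (\<lambda>x. c * F x) = (\<lambda>x. c * transfer_pow m F x)"
  by (induction m) (auto simp: transfer_def algebra_simps)

lemma transfer_pow_const: "transfer_pow m (\<lambda>x. c) = (\<lambda>x. 2 ^ m * c)"
  by (induction m) (auto simp: transfer_def)

lemma transfer_pow_reflect:
  "x \<in> {0..1} \<Longrightarrow> transfer_pow m (\<lambda>x. F (1 - x)) x = transfer_pow m F (1 - x)"
proof (induction m arbitrary: x)
  case (Suc m)
  then show ?case
    using sb_branch_unit[of x] by (simp add: transfer_def sb_branch_reflect)
qed simp

text \<open>The two functionals below measure concavity at the centre and growth at the two neutral
  fixed points \<open>0\<close>, \<open>1\<close>. For \<open>k = 2\<close> and \<open>w = 1/2\<close> they coincide.\<close>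

definition bend :: "real \<Rightarrow> (real \<Rightarrow> real) \<Rightarrow> real" where
  "bend w F = 2 * F (1/2) - F (1/2 - w) - F (1/2 + w)"

definition endpoint_gain :: "nat \<Rightarrow> (real \<Rightarrow> real) \<Rightarrow> real" where
  "endpoint_gain k F = F (1 / real k) + F (1 - 1 / real k) - F 0 - F 1"

text \<open>The branch at each fixed point moves \<open>1/k\<close> to \<open>1/(k+1)\<close> and \<open>1 - 1/k\<close> to \<open>1 - 1/(k+1)\<close>,
  while the other branch moves these points close to \<open>1/2\<close>, one on each side and at equal
  distance.\<close>

lemma endpoint_gain_transfer:
  assumes "2 \<le> k"
  shows "endpoint_gain k (transfer F) = endpoint_gain (Suc k) F - bend (1 / (2 * (2 * real k - 1))) F"
proof -
  have k: "real k \<ge> 2" using assms by simp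
  have 1: "sb_lo (1 / real k) = 1 / real (Suc k)" "sb_hi (1 - 1 / real k) = 1 - 1 / real (Suc k)"
    "sb_hi (1 / real k) = 1/2 + 1 / (2 * (2 * real k - 1))"
    "sb_lo (1 - 1 / real k) = 1/2 - 1 / (2 * (2 * real k - 1))"
    "sb_lo 0 = 0" "sb_lo 1 = 1/2" "sb_hi 0 = 1/2" "sb_hi 1 = 1"
    using k by (auto simp: sb_lo_def sb_hi_def field_simps)
  show ?thesis unfolding endpoint_gain_def transfer_def bend_def 1 by simp
qed

text \<open>Iteration: a main term that only sees the two ends, minus one central second difference
  for each time at which an orbit can leave the neighbourhood of a fixed point.\<close>

lemma endpoint_gain_transfer_pow:
  assumes "2 \<le> k"
  shows "endpoint_gain k (transfer_pow n F) = endpoint_gain (k + n) F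
     - (\<Sum>i<n. bend (1 / (2 * (2 * real (k + i) - 1))) (transfer_pow (n - Suc i) F))"
  using assms
proof (induction n arbitrary: k)
  case (Suc n)
  have "endpoint_gain k (transfer_pow (Suc n) F) = endpoint_gain k (transfer (transfer_pow n F))" by simp
  also have "\<dots> = endpoint_gain (Suc k) (transfer_pow n F) - bend (1 / (2 * (2 * real k - 1))) (transfer_pow n F)"
    by (rule endpoint_gain_transfer) fact
  also have "endpoint_gain (Suc k) (transfer_pow n F) = endpoint_gain (Suc k + n) F
     - (\<Sum>i<n. bend (1 / (2 * (2 * real (Suc k + i) - 1))) (transfer_pow (n - Suc i) F))"
    using Suc.prems by (intro Suc.IH) simp
  finally show ?case by (simp add: sum.lessThan_Suc_shift del: sum.lessThan_Suc funpow.simps)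
qed simp

section \<open>The cone of symmetric concave functions\<close>

lemma concave_sym_mono:
  fixes G :: "real \<Rightarrow> real"
  assumes "concave_on {0..1} G" and sym: "\<And>x. x \<in> {0..1} \<Longrightarrow> G (1 - x) = G x"
    and "0 \<le> x" "x \<le> y" "y \<le> 1/2"
  shows "G x \<le> G y"
proof -
  have "min (G x) (G (1 - x)) \<le> G y"
    by (rule concave_on_ge_min[of x "1 - x"])
       (use assms in \<open>auto simp: concave_on_def intro: convex_on_subset\<close>)
  then show ?thesis using sym[of x] assms by simp
qed

lemma transfer_sym:
  assumes "\<And>x. x \<in> {0..1} \<Longrightarrow> G (1 - x) = G x" "x \<in> {0..1}"
  shows "transfer G (1 - x) = transfer G x"
  using assms sb_branch_unit[of x] by (simp add: transfer_def sb_branch_reflect)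

text \<open>A symmetric concave function increases on \<open>[0, 1/2]\<close>, and \<open>sb_lo\<close> is concave with values
  there, so their composition is concave. By symmetry the other branch gives the mirror
  image of the same function.\<close>

lemma transfer_concave:
  fixes G :: "real \<Rightarrow> real"
  assumes c: "concave_on {0..1} G" and sym: "\<And>x. x \<in> {0..1} \<Longrightarrow> G (1 - x) = G x"
  shows "concave_on {0..1} (transfer G)"
proof -
  have lo: "concave_on {0..1} sb_lo"
  proof (rule f''_le0_imp_concave)
    fix x :: real assume x: "x \<in> {0..1}"
    show "(sb_lo has_field_derivative 1 / (1 + x)\<^sup>2) (at x)"
      unfolding sb_lo_def using x
      by (auto intro!: derivative_eq_intros simp: field_simps power2_eq_square)
    show "((\<lambda>x. 1 / (1 + x)\<^sup>2) has_field_derivative - 2 / (1 + x) ^ 3) (at x)"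
      using x by (auto intro!: derivative_eq_intros simp: divide_simps power2_eq_square power3_eq_cube)
    show "- 2 / (1 + x) ^ 3 \<le> 0" using x by simp
  qed simp
  have B: "concave_on {0..1} (\<lambda>x. G (sb_lo x))"
  proof (rule concave_on_linorderI)
    fix t x y :: real assume t: "0 < t" "t < 1" and xy: "x \<in> {0..1}" "y \<in> {0..1}"
    have r: "sb_lo x \<in> {0..1/2}" "sb_lo y \<in> {0..1/2}" using xy sb_branch_range by blast+
    have z: "(1 - t) *\<^sub>R x + t *\<^sub>R y \<in> {0..1}" 
      using convexD[of "{0..1::real}" x y "1-t" t] xy t by auto
    have r2: "(1 - t) * sb_lo x + t * sb_lo y \<in> {0..1/2}"
      using convexD[of "{0..1/2::real}" "sb_lo x" "sb_lo y" "1-t" t] r t by auto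
    have "(1 - t) * G (sb_lo x) + t * G (sb_lo y) \<le> G ((1 - t) * sb_lo x + t * sb_lo y)"
      using concave_onD[OF c, of t "sb_lo x" "sb_lo y"] t r by simp
    also have "\<dots> \<le> G (sb_lo ((1 - t) *\<^sub>R x + t *\<^sub>R y))"
      by (rule concave_sym_mono[OF c sym])
         (use r2 sb_branch_range(1)[OF z] concave_onD[OF lo, of t x y] t xy in auto)
    finally show "(1 - t) * G (sb_lo x) + t * G (sb_lo y) \<le> G (sb_lo ((1 - t) *\<^sub>R x + t *\<^sub>R y))" .
  qed simp
  have B': "concave_on {0..1} (\<lambda>x. G (sb_hi x))"
  proof (rule concave_on_linorderI)
    fix t x y :: real assume t: "0 < t" "t < 1" and xy: "x \<in> {0..1}" "y \<in> {0..1}"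
    have e: "G (sb_hi u) = G (sb_lo (1 - u))" if "u \<in> {0..1}" for u
      using sym[of "sb_hi u"] sb_branch_unit(2)[OF that] sb_branch_reflect[OF that] by simp
    have z: "(1 - t) *\<^sub>R x + t *\<^sub>R y \<in> {0..1}" 
      using convexD[of "{0..1::real}" x y "1-t" t] xy t by auto
    have a: "1 - ((1 - t) *\<^sub>R x + t *\<^sub>R y) = (1 - t) *\<^sub>R (1 - x) + t *\<^sub>R (1 - y)" by (simp add: algebra_simps)
    show "(1 - t) * G (sb_hi x) + t * G (sb_hi y) \<le> G (sb_hi ((1 - t) *\<^sub>R x + t *\<^sub>R y))"
      unfolding e[OF z] e[OF xy(1)] e[OF xy(2)] a
      using concave_onD[OF B, of t "1 - x" "1 - y"] t xy by simp
  qed simp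
  show ?thesis using concave_on_add[OF B B'] by (simp add: transfer_def[abs_def])
qed

lemma transfer_pow_cone:
  fixes G :: "real \<Rightarrow> real"
  assumes "concave_on {0..1} G" and "\<And>x. x \<in> {0..1} \<Longrightarrow> G (1 - x) = G x"
  shows "concave_on {0..1} (transfer_pow m G) \<and> (\<forall>x\<in>{0..1}. transfer_pow m G (1 - x) = transfer_pow m G x)"
  using assms by (induction m) (auto intro!: transfer_concave transfer_sym simp del: atLeastAtMost_iff)

lemma bend_nonneg:
  assumes "concave_on {0..1} G" "w \<in> {0..1/2}"
  shows "0 \<le> bend w G"
  using concave_onD[OF assms(1), of "1/2" "1/2 - w" "1/2 + w"] assms(2)
  by (auto simp: bend_def field_simps)

text \<open>Symmetrising \<open>F\<close> doubles the central second difference, because the transfer operator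
  commutes with the reflection; so the cone argument applies to arbitrary concave
  functions. By linearity, the second difference is monotone with respect to the order
  defined by concavity of the difference.\<close>

lemma bend_transfer_pow_nonneg:
  fixes F :: "real \<Rightarrow> real"
  assumes c: "concave_on {0..1} F" and w: "w \<in> {0..1/2}"
  shows "0 \<le> bend w (transfer_pow m F)"
proof -
  define G where "G = (\<lambda>x. F x + F (1 - x))"
  have r: "concave_on {0..1} (\<lambda>x. F (1 - x))"
  proof (rule concave_on_linorderI)
    fix t x y :: real assume t: "0 < t" "t < 1" and xy: "x \<in> {0..1}" "y \<in> {0..1}"
    have a: "1 - ((1 - t) *\<^sub>R x + t *\<^sub>R y) = (1 - t) *\<^sub>R (1 - x) + t *\<^sub>R (1 - y)" by (simp add: algebra_simps)
    show "(1 - t) * F (1 - x) + t * F (1 - y) \<le> F (1 - ((1 - t) *\<^sub>R x + t *\<^sub>R y))"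
      unfolding a using concave_onD[OF c, of t "1 - x" "1 - y"] t xy by simp
  qed simp
  have "concave_on {0..1} G" unfolding G_def by (rule concave_on_add[OF c r])
  moreover have "G (1 - x) = G x" for x by (simp add: G_def)
  ultimately have "0 \<le> bend w (transfer_pow m G)"
    using transfer_pow_cone[of G m] w by (intro bend_nonneg) auto
  moreover have "bend w (transfer_pow m G) = 2 * bend w (transfer_pow m F)"
    using w transfer_pow_reflect[of "1/2" m F] transfer_pow_reflect[of "1/2 - w" m F] transfer_pow_reflect[of "1/2 + w" m F]
    by (auto simp: G_def transfer_pow_add bend_def)
  ultimately show ?thesis by simp
qed

section \<open>The Moebius family\<close>

text \<open>Moebius maps with pole determined by \<open>a : b\<close>, normalised to vanish at \<open>0\<close>; their
  derivative is \<open>1/(a(1-x) + bx)\<^sup>2\<close>. If \<open>a\<close> and \<open>b\<close> are the denominators of neighbouring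
  elements of \<open>F\<^sub>n\<close>, then \<open>mob a b\<close> is, up to translation, the map of \<open>[0, 1]\<close> onto the
  interval between them. The lemmas \<open>mob_lo\<close> and \<open>mob_hi\<close> express the passage to the two
  subintervals.\<close>

definition mob :: "real \<Rightarrow> real \<Rightarrow> real \<Rightarrow> real" where
  "mob a b x = x / (a * (a * (1 - x) + b * x))"

lemma mob_denom_pos: "0 < a \<Longrightarrow> 0 < b \<Longrightarrow> x \<in> {0..1} \<Longrightarrow> 0 < a * (1 - x) + b * (x::real)"
  by (cases "x = 1") (auto intro!: add_pos_nonneg)

lemma mob_lo:
  assumes "0 < a" "0 < b" "x \<in> {0..1}"
  shows "mob a b (sb_lo x) = mob a (a + b) x"
proof -
  have x: "1 + x > 0" using assms by auto
  have "a * (1 - sb_lo x) + b * sb_lo x = (a * (1 - x) + (a + b) * x) / (1 + x)"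
    using x by (simp add: sb_lo_def divide_simps) (simp add: algebra_simps)
  then show ?thesis unfolding mob_def using x by (simp add: sb_lo_def)
qed

lemma mob_hi:
  assumes "0 < a" "0 < b" "x \<in> {0..1}"
  shows "mob a b (sb_hi x) = mob (a + b) b x + 1 / (a * (a + b))"
proof -
  have x: "2 - x > 0" using assms by auto
  have p: "(a + b) * (1 - x) + b * x > 0" using mob_denom_pos[of "a + b" b x] assms by simp
  have "a * (1 - sb_hi x) + b * sb_hi x = ((a + b) * (1 - x) + b * x) / (2 - x)"
    using x by (simp add: sb_hi_def divide_simps) (simp add: algebra_simps)
  then have "mob a b (sb_hi x) = 1 / (a * ((a + b) * (1 - x) + b * x))"
    unfolding mob_def using x by (simp add: sb_hi_def)
  also have "\<dots> = mob (a + b) b x + 1 / (a * (a + b))"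
  proof -
    define u where "u = (a + b) * (1 - x) + b * x"
    have u: "u > 0" "u = (a + b) - a * x" using p by (auto simp: u_def algebra_simps)
    have "x * a + u = a + b" using u by (simp add: mult.commute)
    then have "1 / (a * u) = x / ((a + b) * u) + 1 / (a * (a + b))"
      using u(1) assms by (simp add: divide_simps)
    then show ?thesis by (simp add: mob_def u_def)
  qed
  finally show ?thesis .
qed

lemma mob_reflect:
  assumes "0 < a" "0 < b" "x \<in> {0..1}"
  shows "mob b a x = 1 / (a * b) + (- 1) * mob a b (1 - x)"
proof -
  have p: "b * (1 - x) + a * x > 0" using mob_denom_pos[of b a x] assms by simp
  define u where "u = b * (1 - x) + a * x"
  have u: "u > 0" "a * (1 - (1 - x)) + b * (1 - x) = u" using p by (auto simp: u_def algebra_simps)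
  have v: "a * x + b * (1 - x) = u" by (simp add: u_def)
  have "x / (b * u) = 1 / (a * b) + (- 1) * ((1 - x) / (a * u))"
    using u(1) v assms by (simp add: divide_simps) (simp add: algebra_simps)
  then show ?thesis unfolding mob_def u(2) by (simp add: u_def)
qed

lemma mob_scale: "0 < c \<Longrightarrow> mob (c * a) (c * b) x = (1 / c^2) * mob a b x"
proof -
  assume c: "0 < c"
  have "c * a * (c * a * (1 - x) + c * b * x) = c^2 * (a * (a * (1 - x) + b * x))"
    by (simp add: power2_eq_square algebra_simps)
  then show ?thesis unfolding mob_def by simp
qed

text \<open>With \<open>s = (a+b)/2\<close> and \<open>e = (b-a) w\<close>, the denominators at \<open>1/2\<close>, \<open>1/2 - w\<close> and \<open>1/2 + w\<close>
  are \<open>s\<close>, \<open>s - e\<close> and \<open>s + e\<close>.\<close>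

lemma bend_mob:
  assumes "0 < a" "0 < b" "w \<in> {0..1/2}"
  shows "bend w (mob a b) =
    2 * (b - a) * w\<^sup>2 / (((a + b) / 2) * (((a + b) / 2)\<^sup>2 - (b - a)\<^sup>2 * w\<^sup>2))"
proof -
  define s where "s = (a + b) / 2"
  define e where "e = (b - a) * w"
  have d: "a * (1 - (1/2 - w)) + b * (1/2 - w) = s - e" "a * (1 - (1/2 + w)) + b * (1/2 + w) = s + e"
    "a * (1 - 1/2) + b * (1/2) = s" by (simp_all add: s_def e_def algebra_simps add_divide_distrib)
  have p: "s - e > 0" "s + e > 0"
    using mob_denom_pos[of a b "1/2 - w"] mob_denom_pos[of a b "1/2 + w"] assms unfolding d by auto
  then have s: "s > 0" by simp
  define q where "q = (s - e) * (s + e)"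
  have q: "q > 0" "q = s\<^sup>2 - e\<^sup>2"
    using mult_pos_pos[OF p] by (simp_all add: q_def power2_eq_square algebra_simps)
  have "bend w (mob a b) = 1 / (a * s) - (1/2 - w) / (a * (s - e)) - (1/2 + w) / (a * (s + e))"
    unfolding bend_def mob_def d by simp
  also have "1 / (a * s) = q / (a * s * q)" using q by simp
  also have "(1/2 - w) / (a * (s - e)) = (1/2 - w) * s * (s + e) / (a * s * q)"
    using p s by (simp add: q_def)
  also have "(1/2 + w) / (a * (s + e)) = (1/2 + w) * s * (s - e) / (a * s * q)"
    using p s by (simp add: q_def)
  also have "q / (a * s * q) - (1/2 - w) * s * (s + e) / (a * s * q) - (1/2 + w) * s * (s - e) / (a * s * q)
      = (q - (1/2 - w) * s * (s + e) - (1/2 + w) * s * (s - e)) / (a * s * q)"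
    by (simp only: diff_divide_distrib)
  also have "q - (1/2 - w) * s * (s + e) - (1/2 + w) * s * (s - e) = e * (2 * w * s - e)"
    unfolding q_def by (simp add: algebra_simps add_divide_distrib diff_divide_distrib)
  also have "2 * w * s - e = 2 * w * a" by (simp add: s_def e_def algebra_simps)
  also have "e * (2 * w * a) / (a * s * q) = 2 * (b - a) * w\<^sup>2 / (s * q)"
    using assms by (simp add: e_def power2_eq_square)
  finally have "bend w (mob a b) = 2 * (b - a) * w\<^sup>2 / (s * (s\<^sup>2 - e\<^sup>2))"
    unfolding q(2) .
  then show ?thesis by (simp add: s_def e_def power_mult_distrib)
qed

lemma bend_cong: "w \<in> {0..1/2} \<Longrightarrow> (\<And>x. x \<in> {0..1} \<Longrightarrow> F x = G x) \<Longrightarrow> bend w F = bend w G"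
  by (auto simp: bend_def)

lemma bend_transfer_pow_cong:
  assumes "w \<in> {0..1/2}" "\<And>x. x \<in> {0..1} \<Longrightarrow> F x = G x"
  shows "bend w (transfer_pow m F) = bend w (transfer_pow m G)"
  by (rule bend_cong[OF assms(1)]) (rule transfer_pow_cong[OF assms(2)])

lemma bend_transfer_pow_linear:
  "bend w (transfer_pow m (\<lambda>x. F x + G x)) = bend w (transfer_pow m F) + bend w (transfer_pow m G)"
  "bend w (transfer_pow m (\<lambda>x. c * F x)) = c * bend w (transfer_pow m F)"
  "bend w (transfer_pow m (\<lambda>x. c)) = 0"
  by (simp_all add: bend_def transfer_pow_add transfer_pow_cmult transfer_pow_const algebra_simps)

text \<open>Viewed as a function of \<open>(a, b)\<close>, this quantity satisfies the Stern-Brocot recursion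
  \<open>mob_bend_Suc\<close>, is homogeneous of degree \<open>-2\<close> and odd under exchange of \<open>a\<close> and \<open>b\<close>. It
  is therefore determined by its profile \<open>x \<mapsto> mob_bend w m x (1 - x)\<close> on \<open>(0, 1/2]\<close>.\<close>

definition mob_bend :: "real \<Rightarrow> nat \<Rightarrow> real \<Rightarrow> real \<Rightarrow> real" where
  "mob_bend w m a b = bend w (transfer_pow m (mob a b))"

lemma mob_bend_Suc:
  assumes "0 < a" "0 < b" "w \<in> {0..1/2}"
  shows "mob_bend w (Suc m) a b = mob_bend w m a (a + b) + mob_bend w m (a + b) b"
proof -
  have "mob_bend w (Suc m) a b =
      bend w (transfer_pow m (\<lambda>x. mob a (a + b) x + (mob (a + b) b x + 1 / (a * (a + b)))))"
    unfolding mob_bend_def transfer_pow_Suc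
    by (intro bend_transfer_pow_cong assms(3)) (simp add: transfer_def mob_lo mob_hi assms)
  then show ?thesis
    by (simp only: bend_transfer_pow_linear mob_bend_def)
qed

lemma mob_bend_scale:
  "0 < c \<Longrightarrow> mob_bend w m (c * a) (c * b) = mob_bend w m a b / c\<^sup>2"
proof -
  assume "0 < c"
  then have "mob (c * a) (c * b) = (\<lambda>x. (1 / c\<^sup>2) * mob a b x)"
    by (intro ext mob_scale)
  then show ?thesis by (simp only: mob_bend_def bend_transfer_pow_linear) simp
qed

lemma mob_bend_swap:
  assumes "0 < a" "0 < b" "w \<in> {0..1/2}"
  shows "mob_bend w m b a = - mob_bend w m a b"
proof -
  have "mob_bend w m b a = bend w (transfer_pow m (\<lambda>x. 1 / (a * b) + (- 1) * mob a b (1 - x)))"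
    unfolding mob_bend_def by (intro bend_transfer_pow_cong mob_reflect assms)
  also have "\<dots> = - bend w (transfer_pow m (\<lambda>x. mob a b (1 - x)))"
    by (simp only: bend_transfer_pow_linear)
  also have "bend w (transfer_pow m (\<lambda>x. mob a b (1 - x))) = bend w (transfer_pow m (mob a b))"
    using assms(3) transfer_pow_reflect[of "1/2" m "mob a b"] transfer_pow_reflect[of "1/2 - w" m "mob a b"]
      transfer_pow_reflect[of "1/2 + w" m "mob a b"] by (simp add: bend_def)
  finally show ?thesis by (simp add: mob_bend_def)
qed

text \<open>Oddness moves the second child back to the range \<open>(0, 1/2]\<close> at the price of a minus
  sign.\<close>

lemma mob_bend_profile_Suc:
  assumes "x \<in> {0<..1/2}" "w \<in> {0..1/2}"
  shows "mob_bend w (Suc m) x (1 - x) =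
    mob_bend w m (sb_lo x) (1 - sb_lo x) / (1 + x)\<^sup>2
    - mob_bend w m (1 - sb_hi x) (1 - (1 - sb_hi x)) / (2 - x)\<^sup>2"
proof -
  have x: "0 < x" "x \<le> 1/2" using assms by auto
  have "mob_bend w (Suc m) x (1 - x) = mob_bend w m x 1 + mob_bend w m 1 (1 - x)"
    using mob_bend_Suc[of x "1 - x" w m] x assms by simp
  also have "mob_bend w m 1 (1 - x) = - mob_bend w m (1 - x) 1"
    by (rule mob_bend_swap) (use x assms in auto)
  also have "mob_bend w m x 1 = mob_bend w m ((1 + x) * sb_lo x) ((1 + x) * (1 - sb_lo x))"
  proof -
    have "(1 + x) * sb_lo x = x" "(1 + x) * (1 - sb_lo x) = 1"
      using x by (simp_all add: sb_lo_def right_diff_distrib)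
    then show ?thesis by (simp only:)
  qed
  also have "mob_bend w m (1 - x) 1 = mob_bend w m ((2 - x) * (1 - sb_hi x)) ((2 - x) * (1 - (1 - sb_hi x)))"
  proof -
    have "(2 - x) * (1 - sb_hi x) = 1 - x" "(2 - x) * (1 - (1 - sb_hi x)) = 1"
      using x by (simp_all add: sb_hi_def right_diff_distrib)
    then show ?thesis by (simp only:)
  qed
  finally show ?thesis using x by (simp add: mob_bend_scale)
qed

text \<open>In the recursion the first term decreases in \<open>x\<close>. In the second term the argument
  \<open>(1-x)/(2-x)\<close> decreases and the factor \<open>1/(2-x)\<^sup>2\<close> increases with \<open>x\<close>, so the subtracted
  quantity increases. Non-negativity follows by comparing the two arguments, since
  \<open>x/(1+x) \<le> (1-x)/(2-x)\<close> on this range.\<close>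

lemma mob_bend_profile_antimono:
  assumes w: "w \<in> {0..1/2}" and "0 < x" "x \<le> y" "y \<le> 1/2"
  shows "0 \<le> mob_bend w m y (1 - y) \<and> mob_bend w m y (1 - y) \<le> mob_bend w m x (1 - x)"
  using assms(2-)
proof (induction m arbitrary: x y)
  case 0
  have e: "mob_bend w 0 z (1 - z) = 16 * (w\<^sup>2 * ((1 - 2 * z) / (1 - 4 * w\<^sup>2 * (1 - 2 * z)\<^sup>2)))" 
    if "0 < z" "z \<le> 1/2" for z
  proof -
    have "mob_bend w 0 z (1 - z) = 2 * (1 - 2 * z) * w\<^sup>2 / ((1/2) * ((1/2)\<^sup>2 - (1 - 2 * z)\<^sup>2 * w\<^sup>2))"
      using bend_mob[of z "1 - z" w] that w by (simp add: mob_bend_def)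
    also have "(1/2::real) * ((1/2)\<^sup>2 - (1 - 2 * z)\<^sup>2 * w\<^sup>2) = (1 - 4 * w\<^sup>2 * (1 - 2 * z)\<^sup>2) / 8"
      by (simp add: power2_eq_square)
    finally show ?thesis by simp
  qed
  have pos: "0 < 1 - 4 * w\<^sup>2 * (1 - 2 * x)\<^sup>2"
  proof -
    have "2 * w * (1 - 2 * x) \<le> 1 * (1 - 2 * x)" using w 0 by (intro mult_right_mono) auto
    also have "\<dots> < 1" using 0 by simp
    finally have "(2 * w * (1 - 2 * x))\<^sup>2 < 1" using w 0 by (intro power_less_one_iff[THEN iffD2]) auto
    then show ?thesis by (simp add: power_mult_distrib)
  qed
  have sq: "(1 - 2 * y)\<^sup>2 \<le> (1 - 2 * x)\<^sup>2" using 0 by (intro power_mono) auto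
  have le: "1 - 4 * w\<^sup>2 * (1 - 2 * x)\<^sup>2 \<le> 1 - 4 * w\<^sup>2 * (1 - 2 * y)\<^sup>2"
    using sq by (simp add: mult_left_mono)
  have "(1 - 2 * y) / (1 - 4 * w\<^sup>2 * (1 - 2 * y)\<^sup>2) \<le> (1 - 2 * x) / (1 - 4 * w\<^sup>2 * (1 - 2 * x)\<^sup>2)"
    using 0 pos le by (intro frac_le) auto
  then have "16 * (w\<^sup>2 * ((1 - 2 * y) / (1 - 4 * w\<^sup>2 * (1 - 2 * y)\<^sup>2)))
      \<le> 16 * (w\<^sup>2 * ((1 - 2 * x) / (1 - 4 * w\<^sup>2 * (1 - 2 * x)\<^sup>2)))"
    by (intro mult_left_mono) auto
  moreover have "0 \<le> 16 * (w\<^sup>2 * ((1 - 2 * y) / (1 - 4 * w\<^sup>2 * (1 - 2 * y)\<^sup>2)))"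
    using 0 pos le by (intro mult_nonneg_nonneg divide_nonneg_pos) auto
  ultimately show ?case using 0 e[of x] e[of y] by simp
next
  case (Suc m)
  let ?h = "\<lambda>z. mob_bend w m z (1 - z)"
  have rng: "0 < sb_lo z" "sb_lo z \<le> 1 - sb_hi z" "1 - sb_hi z \<le> 1/2" if "0 < z" "z \<le> 1/2" for z
    using that by (auto simp: sb_lo_def sb_hi_def divide_simps) (simp_all add: algebra_simps)
  have lo: "sb_lo x \<le> sb_lo y" and hi: "1 - sb_hi y \<le> 1 - sb_hi x"
    using Suc.prems by (auto simp: sb_lo_def sb_hi_def field_simps)
  note rx = rng[of x] and ry = rng[of y]
  have rec: "mob_bend w (Suc m) z (1 - z) = ?h (sb_lo z) / (1 + z)\<^sup>2 - ?h (1 - sb_hi z) / (2 - z)\<^sup>2"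
    if "0 < z" "z \<le> 1/2" for z
    by (rule mob_bend_profile_Suc) (use that w in auto)
  have y: "0 < y" "x \<le> 1/2" using Suc.prems by auto
  have "?h (1 - sb_hi y) / (2 - y)\<^sup>2 \<le> ?h (sb_lo y) / (1 + y)\<^sup>2"
    using Suc.IH[of "sb_lo y" "1 - sb_hi y"] ry y Suc.prems
    by (intro frac_le power_mono) auto
  moreover have "?h (sb_lo y) / (1 + y)\<^sup>2 \<le> ?h (sb_lo x) / (1 + x)\<^sup>2"
    using Suc.IH[of "sb_lo x" "sb_lo y"] rx ry lo y Suc.prems
    by (intro frac_le power_mono) auto
  moreover have "?h (1 - sb_hi x) / (2 - x)\<^sup>2 \<le> ?h (1 - sb_hi y) / (2 - y)\<^sup>2"
    using Suc.IH[of "1 - sb_hi y" "1 - sb_hi x"] rx ry hi y Suc.prems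
    by (intro frac_le power_mono) auto
  ultimately show ?case using rec[of x] rec[of y] Suc.prems y by auto
qed

text \<open>Only the run towards the fixed point \<open>0\<close> is kept; the factors \<open>1/(1+x)\<^sup>2\<close> along \<open>x,
  x/(1+x), x/(1+2x), \<dots>\<close> telescope. This is where the sign in the recursion is used:
  without it only a much weaker decay would result.\<close>

lemma mob_bend_profile_decay:
  assumes w: "w \<in> {0..1/6}" and "0 < x" "x \<le> 1/2"
  shows "mob_bend w m x (1 - x) \<le> 18 * w\<^sup>2 / (1 + real m * x)\<^sup>2"
  using assms(2-)
proof (induction m arbitrary: x)
  case 0
  have w2: "w\<^sup>2 \<le> 1/36" using power_mono[of w "1/6" 2] w by (simp add: power2_eq_square)
  have d: "0 \<le> 1 - 2 * x" "1 - 2 * x \<le> 1" "(1 - 2 * x)\<^sup>2 \<le> 1"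
    using 0 by (auto simp: power_le_one)
  have m: "(1 - 2 * x)\<^sup>2 * w\<^sup>2 \<le> 1/36"
    using mult_mono[OF d(3) w2] by simp
  have "mob_bend w 0 x (1 - x) = 2 * (1 - 2 * x) * w\<^sup>2 / ((1/2) * ((1/2)\<^sup>2 - (1 - 2 * x)\<^sup>2 * w\<^sup>2))"
    using bend_mob[of x "1 - x" w] 0 w by (simp add: mob_bend_def)
  also have "\<dots> \<le> (2 * 1 * w\<^sup>2) / (1/9)"
    using d m by (intro frac_le mult_right_mono mult_left_mono) (auto simp: power2_eq_square)
  finally show ?case by simp
next
  case (Suc m)
  have w': "w \<in> {0..1/2}" using w by auto
  have r: "0 < sb_lo x" "sb_lo x \<le> 1/2" "0 < 1 - sb_hi x" "1 - sb_hi x \<le> 1/2"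
    using Suc.prems by (auto simp: sb_lo_def sb_hi_def field_simps)
  have "mob_bend w (Suc m) x (1 - x) \<le> mob_bend w m (sb_lo x) (1 - sb_lo x) / (1 + x)\<^sup>2"
    using mob_bend_profile_Suc[of x w m] mob_bend_profile_antimono[OF w' r(3) order_refl r(4), of m] Suc.prems w' by simp
  also have "\<dots> \<le> (18 * w\<^sup>2 / (1 + real m * sb_lo x)\<^sup>2) / (1 + x)\<^sup>2"
    using Suc.IH[OF r(1,2)] by (intro divide_right_mono) auto
  also have "\<dots> = 18 * w\<^sup>2 / ((1 + real m * sb_lo x) * (1 + x))\<^sup>2"
    by (simp add: power_mult_distrib)
  also have "(1 + real m * sb_lo x) * (1 + x) = 1 + real (Suc m) * x"
    using Suc.prems by (simp add: sb_lo_def field_simps)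
  finally show ?case .
qed

text \<open>The profile at \<open>x = 1/3\<close>, rescaled to the pair \<open>(1, 2)\<close>.\<close>

lemma bend_transfer_reference:
  assumes "w \<in> {0..1/6}"
  shows "bend w (transfer_pow m (mob 1 2)) \<le> 18 * w\<^sup>2 / (real m + 3)\<^sup>2"
proof -
  have "bend w (transfer_pow m (mob 1 2)) = mob_bend w m (3 * (1/3)) (3 * (1 - 1/3))" by (simp add: mob_bend_def)
  also have "\<dots> = mob_bend w m (1/3) (1 - 1/3) / 3\<^sup>2" by (rule mob_bend_scale) simp
  also have "\<dots> \<le> (18 * w\<^sup>2 / (1 + real m * (1/3))\<^sup>2) / 3\<^sup>2"
    using mob_bend_profile_decay[OF assms, of "1/3" m] by (intro divide_right_mono) auto
  also have "\<dots> = 18 * w\<^sup>2 / ((1 + real m * (1/3)) * 3)\<^sup>2"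
    by (simp only: power_mult_distrib divide_divide_eq_left)
  also have "(1 + real m * (1/3)) * 3 = real m + 3" by simp
  finally show ?thesis .
qed

section \<open>Asymptotics of the endpoint gain\<close>

text \<open>Two-sided comparison with the reference function \<open>mob 1 2\<close>, that is \<open>x/(1+x)\<close>, in the
  order given by the cone of concave functions.\<close>

definition dominated :: "real \<Rightarrow> (real \<Rightarrow> real) \<Rightarrow> bool" where
  "dominated C F \<longleftrightarrow> concave_on {0..1} (\<lambda>x. C * mob 1 2 x + F x) \<and>
     concave_on {0..1} (\<lambda>x. C * mob 1 2 x + (- 1) * F x)"

lemma mob_deriv:
  assumes "0 < a" "0 < b" "x \<in> {0..1}"
  shows "(mob a b has_field_derivative 1 / (a * (1 - x) + b * x)\<^sup>2) (at x)"
    "((\<lambda>x. 1 / (a * (1 - x) + b * x)\<^sup>2) has_field_derivative - 2 * (b - a) / (a * (1 - x) + b * x) ^ 3) (at x)"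
proof -
  define u where "u = a * (1 - x) + b * x"
  have u: "u > 0" using mob_denom_pos[OF assms] by (simp add: u_def)
  have lin: "((\<lambda>x. a * (1 - x) + b * x) has_field_derivative (b - a)) (at x)"
    by (auto intro!: derivative_eq_intros)
  have "((\<lambda>x. x / (a * (a * (1 - x) + b * x))) has_field_derivative
      (1 * (a * u) - x * (a * (b - a))) / (a * u * (a * u))) (at x)"
    unfolding u_def by (rule DERIV_divide[OF DERIV_ident DERIV_cmult[OF lin]]) (use u assms in \<open>simp add: u_def[symmetric]\<close>)
  moreover have "1 * (a * u) - x * (a * (b - a)) = a * a" by (simp add: u_def algebra_simps)
  ultimately show "(mob a b has_field_derivative 1 / (a * (1 - x) + b * x)\<^sup>2) (at x)"
    using assms by (simp add: mob_def[abs_def] u_def[symmetric] power2_eq_square)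
  have "((\<lambda>x. 1 / (a * (1 - x) + b * x)\<^sup>2) has_field_derivative
      (0 * u\<^sup>2 - 1 * (real 2 * ((b - a) * u ^ (2 - Suc 0)))) / (u\<^sup>2 * u\<^sup>2)) (at x)"
    unfolding u_def by (rule DERIV_divide[OF DERIV_const DERIV_power[OF lin]]) (use u in \<open>simp add: u_def[symmetric]\<close>)
  moreover have "(0 * u\<^sup>2 - 1 * (real 2 * ((b - a) * u ^ (2 - Suc 0)))) / (u\<^sup>2 * u\<^sup>2) = - 2 * (b - a) / u ^ 3"
    using u by (simp add: power2_eq_square power3_eq_cube minus_divide_left mult.assoc)
  ultimately show "((\<lambda>x. 1 / (a * (1 - x) + b * x)\<^sup>2) has_field_derivative - 2 * (b - a) / (a * (1 - x) + b * x) ^ 3) (at x)"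
    by (simp only: u_def)
qed

text \<open>The reference function has second derivative at most \<open>-1/4\<close> on \<open>[0, 1]\<close>.\<close>

lemma dominatedI:
  assumes F': "\<And>x. x \<in> {0..1} \<Longrightarrow> (F has_field_derivative F' x) (at x)"
    and F'': "\<And>x. x \<in> {0..1} \<Longrightarrow> (F' has_field_derivative F'' x) (at x)"
    and le: "\<And>x. x \<in> {0..1} \<Longrightarrow> 4 * \<bar>F'' x\<bar> \<le> C"
  shows "dominated C F"
proof -
  have *: "concave_on {0..1} (\<lambda>x. C * mob 1 2 x + s * F x)" if s: "\<bar>s\<bar> = 1" for s
  proof (rule f''_le0_imp_concave)
    fix x :: real assume x: "x \<in> {0..1}"
    show "((\<lambda>x. C * mob 1 2 x + s * F x) has_field_derivative C * (1 / (1 * (1 - x) + 2 * x)\<^sup>2) + s * F' x) (at x)"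
      by (intro DERIV_add DERIV_cmult mob_deriv F' x) auto
    show "((\<lambda>x. C * (1 / (1 * (1 - x) + 2 * x)\<^sup>2) + s * F' x) has_field_derivative
        C * (- 2 * (2 - 1) / (1 * (1 - x) + 2 * x) ^ 3) + s * F'' x) (at x)"
      by (intro DERIV_add DERIV_cmult mob_deriv F'' x) auto
    have C: "0 \<le> C" using le[OF x] by linarith
    have "(1 * (1 - x) + 2 * x) ^ 3 \<le> 2 ^ 3" using x by (intro power_mono) auto
    then have "2 / 8 \<le> 2 / (1 * (1 - x) + 2 * x) ^ 3"
      using x by (intro divide_left_mono mult_pos_pos zero_less_power) auto
    then have "C * (2 / 8) \<le> C * (2 / (1 * (1 - x) + 2 * x) ^ 3)" by (rule mult_left_mono) fact
    moreover have "s * F'' x \<le> \<bar>F'' x\<bar>" using s abs_ge_self[of "s * F'' x"] by (simp add: abs_mult)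
    ultimately show "C * (- 2 * (2 - 1) / (1 * (1 - x) + 2 * x) ^ 3) + s * F'' x \<le> 0"
      using le[OF x] by simp
  qed simp
  show ?thesis using *[of 1] *[of "- 1"] by (simp add: dominated_def)
qed

lemma dominated_square: "dominated 8 (\<lambda>x. x\<^sup>2)"
  by (rule dominatedI[where F' = "\<lambda>x. 2 * x" and F'' = "\<lambda>x. 2"]) (auto intro!: derivative_eq_intros)

lemma dominated_mob:
  assumes "0 < m" "m \<le> a" "m \<le> b"
  shows "dominated (8 * \<bar>b - a\<bar> / m ^ 3) (mob a b)"
proof (rule dominatedI)
  fix x :: real assume x: "x \<in> {0..1}"
  have ab: "0 < a" "0 < b" using assms by auto
  show "(mob a b has_field_derivative 1 / (a * (1 - x) + b * x)\<^sup>2) (at x)"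
    "((\<lambda>x. 1 / (a * (1 - x) + b * x)\<^sup>2) has_field_derivative - 2 * (b - a) / (a * (1 - x) + b * x) ^ 3) (at x)"
    using mob_deriv[OF ab x] by auto
  have "m * (1 - x) + m * x \<le> a * (1 - x) + b * x" using x assms by (intro add_mono mult_right_mono) auto
  then have m: "m \<le> a * (1 - x) + b * x" by (simp add: algebra_simps)
  then have "4 * \<bar>- 2 * (b - a) / (a * (1 - x) + b * x) ^ 3\<bar> = 8 * \<bar>b - a\<bar> / (a * (1 - x) + b * x) ^ 3"
    using assms unfolding abs_divide abs_mult power_abs by simp
  also have "\<dots> \<le> 8 * \<bar>b - a\<bar> / m ^ 3" using m assms by (intro divide_left_mono power_mono mult_pos_pos zero_less_power) auto
  finally show "4 * \<bar>- 2 * (b - a) / (a * (1 - x) + b * x) ^ 3\<bar> \<le> 8 * \<bar>b - a\<bar> / m ^ 3" .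
qed

lemma dominated_nonneg: 
  assumes "dominated C F" shows "0 \<le> C"
proof -
  have "concave_on {0..1} (\<lambda>x. (C * mob 1 2 x + F x) + (C * mob 1 2 x + (- 1) * F x))"
    by (rule concave_on_add[OF conjunct1 conjunct2]) (use assms[unfolded dominated_def] in blast)+
  then have "0 \<le> bend (1/2) (\<lambda>x. (C * mob 1 2 x + F x) + (C * mob 1 2 x + (- 1) * F x))"
    by (rule bend_nonneg) auto
  then show ?thesis by (simp add: bend_def mob_def)
qed

lemma bend_dominated:
  assumes "dominated C F" "w \<in> {0..1/6}"
  shows "\<bar>bend w (transfer_pow m F)\<bar> \<le> C * (18 * w\<^sup>2 / (real m + 3)\<^sup>2)"
proof -
  have w: "w \<in> {0..1/2}" using assms by auto
  have "0 \<le> bend w (transfer_pow m (\<lambda>x. C * mob 1 2 x + F x))"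
    "0 \<le> bend w (transfer_pow m (\<lambda>x. C * mob 1 2 x + (- 1) * F x))"
    using assms(1) w unfolding dominated_def by (blast intro: bend_transfer_pow_nonneg)+
  then have "\<bar>bend w (transfer_pow m F)\<bar> \<le> C * bend w (transfer_pow m (mob 1 2))"
    unfolding bend_transfer_pow_linear by linarith
  also have "\<dots> \<le> C * (18 * w\<^sup>2 / (real m + 3)\<^sup>2)"
    by (intro mult_left_mono bend_transfer_reference dominated_nonneg[OF assms(1)] assms(2))
  finally show ?thesis .
qed

lemma sum_inverse_squares_le: "(\<Sum>i<n. 1 / (real i + 3)\<^sup>2) \<le> 1 / 2"
proof -
  have "(\<Sum>i<n. 1 / (real i + 3)\<^sup>2) \<le> 1 / 2 - 1 / (real n + 2)"
  proof (induction n)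
    case (Suc n)
    have "1 / (real n + 3)\<^sup>2 \<le> 1 / ((real n + 2) * (real n + 3))"
      unfolding power2_eq_square by (intro divide_left_mono mult_right_mono) auto
    also have "\<dots> = 1 / (real n + 2) - 1 / (real (Suc n) + 2)" by (simp add: field_simps)
    finally show ?case using Suc.IH by simp
  qed simp
  then show ?thesis by (smt (verit) divide_nonneg_nonneg of_nat_0_le_iff)
qed

text \<open>The two factors have constant sum \<open>T = u + v\<close>, and \<open>1/(uv)\<^sup>2 = (1/u + 1/v)\<^sup>2/T\<^sup>2\<close>.\<close>

lemma sum_product_inverse_squares_le:
  "(\<Sum>i<n. 1 / ((real i + 3)\<^sup>2 * (real (n - Suc i) + 3)\<^sup>2)) \<le> 2 / (real n + 5)\<^sup>2"
proof -
  let ?T = "real n + 5"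
  have "1 / ((real i + 3)\<^sup>2 * (real (n - Suc i) + 3)\<^sup>2) \<le>
      2 / ?T\<^sup>2 * (1 / (real i + 3)\<^sup>2 + 1 / (real (n - Suc i) + 3)\<^sup>2)" if "i < n" for i
  proof -
    define u v where "u = real i + 3" and "v = real (n - Suc i) + 3"
    have p: "u > 0" "v > 0" by (auto simp: u_def v_def)
    have T: "?T = u + v" using that by (simp add: u_def v_def)
    have "(u + v)\<^sup>2 \<le> 2 * (u\<^sup>2 + v\<^sup>2)"
      using zero_le_power2[of "u - v"] by (simp add: power2_eq_square algebra_simps)
    then have "1 / (u\<^sup>2 * v\<^sup>2) \<le> 2 / (u + v)\<^sup>2 * (1 / u\<^sup>2 + 1 / v\<^sup>2)"
      using p by (simp add: divide_simps)
    then show ?thesis by (simp add: T u_def v_def)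
  qed
  then have "(\<Sum>i<n. 1 / ((real i + 3)\<^sup>2 * (real (n - Suc i) + 3)\<^sup>2)) \<le>
     (\<Sum>i<n. 2 / ?T\<^sup>2 * (1 / (real i + 3)\<^sup>2 + 1 / (real (n - Suc i) + 3)\<^sup>2))"
    by (intro sum_mono) auto
  also have "\<dots> = 2 / ?T\<^sup>2 * ((\<Sum>i<n. 1 / (real i + 3)\<^sup>2) + (\<Sum>i<n. 1 / (real (n - Suc i) + 3)\<^sup>2))"
    by (simp only: sum_distrib_left[symmetric] sum.distrib)
  also have "(\<Sum>i<n. 1 / (real (n - Suc i) + 3)\<^sup>2) = (\<Sum>i<n. 1 / (real i + 3)\<^sup>2)"
    by (rule sum.nat_diff_reindex)
  also have "2 / ?T\<^sup>2 * ((\<Sum>i<n. 1 / (real i + 3)\<^sup>2) + (\<Sum>i<n. 1 / (real i + 3)\<^sup>2)) \<le> 2 / ?T\<^sup>2 * 1"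
    using sum_inverse_squares_le[of n] by (intro mult_left_mono) auto
  finally show ?thesis by simp
qed

lemma endpoint_gain_asymptotics:
  assumes "dominated C F"
  shows "\<bar>endpoint_gain 2 (transfer_pow n F) - endpoint_gain (n + 2) F\<bar> \<le> 9 * C / (real n + 2)\<^sup>2"
proof -
  have C: "0 \<le> C" using assms by (rule dominated_nonneg)
  let ?w = "\<lambda>i. 1 / (2 * (2 * real (2 + i) - 1))"
  have t: "\<bar>bend (?w i) (transfer_pow (n - Suc i) F)\<bar> \<le>
      9 / 2 * C * (1 / ((real i + 3)\<^sup>2 * (real (n - Suc i) + 3)\<^sup>2))" for i
  proof -
    have "\<bar>bend (?w i) (transfer_pow (n - Suc i) F)\<bar> \<le> C * (18 * (?w i)\<^sup>2 / (real (n - Suc i) + 3)\<^sup>2)"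
      by (rule bend_dominated[OF assms]) (auto simp: field_simps)
    also have "?w i \<le> 1 / (2 * (real i + 3))" by (intro divide_left_mono) auto
    then have "(?w i)\<^sup>2 \<le> (1 / (2 * (real i + 3)))\<^sup>2" by (intro power_mono) auto
    then have "C * (18 * (?w i)\<^sup>2 / (real (n - Suc i) + 3)\<^sup>2) \<le>
        C * (18 * (1 / (2 * (real i + 3)))\<^sup>2 / (real (n - Suc i) + 3)\<^sup>2)"
      using C by (intro mult_left_mono divide_right_mono) auto
    also have "\<dots> = 9 / 2 * C * (1 / ((real i + 3)\<^sup>2 * (real (n - Suc i) + 3)\<^sup>2))"
      unfolding power_divide power_mult_distrib by simp
    finally show ?thesis .
  qed
  have "\<bar>endpoint_gain 2 (transfer_pow n F) - endpoint_gain (n + 2) F\<bar> =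
      \<bar>\<Sum>i<n. bend (?w i) (transfer_pow (n - Suc i) F)\<bar>"
    using endpoint_gain_transfer_pow[of 2 n F] by (simp add: add.commute)
  also have "\<dots> \<le> (\<Sum>i<n. 9 / 2 * C * (1 / ((real i + 3)\<^sup>2 * (real (n - Suc i) + 3)\<^sup>2)))"
    by (rule order_trans[OF sum_abs]) (intro sum_mono t)
  also have "\<dots> = 9 / 2 * C * (\<Sum>i<n. 1 / ((real i + 3)\<^sup>2 * (real (n - Suc i) + 3)\<^sup>2))"
    by (simp only: sum_distrib_left)
  also have "\<dots> \<le> 9 / 2 * C * (2 / (real n + 5)\<^sup>2)"
    using C by (intro mult_left_mono sum_product_inverse_squares_le) auto
  also have "\<dots> \<le> 9 / 2 * C * (2 / (real n + 2)\<^sup>2)"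
    using C by (intro mult_left_mono divide_left_mono power_mono) auto
  finally show ?thesis by simp
qed

text \<open>Near \<open>0\<close> and \<open>1\<close> the map \<open>mob a b\<close> has slopes \<open>1/a\<^sup>2\<close> and \<open>1/b\<^sup>2\<close>.\<close>

lemma endpoint_gain_mob:
  assumes "0 < m" "m \<le> a" "m \<le> b" "2 \<le> k"
  shows "\<bar>endpoint_gain k (mob a b) - (1 / a\<^sup>2 - 1 / b\<^sup>2) / real k\<bar> \<le> 2 * (\<bar>b - a\<bar> / m ^ 3) / (real k)\<^sup>2"
proof -
  define K where "K = real k"
  have K: "K \<ge> 2" using assms by (simp add: K_def)
  have key: "\<bar>1 / (a * (a * (K - 1) + b)) - 1 / a\<^sup>2 / K\<bar> \<le> \<bar>b - a\<bar> / m ^ 3 / K\<^sup>2"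
    if ab: "m \<le> a" "m \<le> b" for a b
  proof -
    define u where "u = a * (K - 1) + b"
    have "m * (K - 1) + m \<le> u" unfolding u_def using ab K by (intro add_mono mult_right_mono) auto
    then have u: "m * K \<le> u" by (simp add: algebra_simps)
    have pos: "0 < m * K" "0 < a" "0 < K" using assms K ab by auto
    with u have u0: "u > 0" by linarith
    have e: "a * K - u = a - b" by (simp add: u_def algebra_simps)
    have "1 / (a * u) - 1 / a\<^sup>2 / K = (a * K - u) / (a\<^sup>2 * K * u)"
      using pos u0 by (simp add: divide_simps power2_eq_square) 
    then have "\<bar>1 / (a * u) - 1 / a\<^sup>2 / K\<bar> = \<bar>b - a\<bar> / (a\<^sup>2 * K * u)"
      using pos u0 unfolding e by (simp add: abs_mult abs_minus_commute)
    also have "\<dots> \<le> \<bar>b - a\<bar> / (m\<^sup>2 * K * (m * K))"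
      using u pos ab assms u0 by (intro divide_left_mono mult_mono power_mono mult_pos_pos) auto
    also have "m\<^sup>2 * K * (m * K) = m ^ 3 * K\<^sup>2" by (simp add: power2_eq_square power3_eq_cube)
    finally show ?thesis by (simp add: u_def)
  qed
  have ab: "0 < a" "0 < b" using assms by auto
  have 1: "mob a b (1 / K) - mob a b 0 = 1 / (a * (a * (K - 1) + b))"
  proof -
    have "K * (a * (1 - 1 / K) + b * (1 / K)) = a * (K - 1) + b" using K by (simp add: field_simps)
    then show ?thesis using K by (simp add: mob_def)
  qed
  have 2: "mob a b (1 - 1 / K) - mob a b 1 = - (1 / (b * (b * (K - 1) + a)))"
  proof -
    have K01: "1 / K \<in> {0..1}" "1 - 1 / K \<in> {0..1}" using K by auto
    have "mob a b 1 = 1 / (a * b)" using ab by (simp add: mob_def)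
    then have "mob a b (1 - 1 / K) - mob a b 1 = - mob b a (1 / K)"
      using mob_reflect[OF ab K01(1)] by simp
    also have "K * (b * (1 - 1 / K) + a * (1 / K)) = b * (K - 1) + a" using K by (simp add: field_simps)
    then have "mob b a (1 / K) = 1 / (b * (b * (K - 1) + a))" 
      using K by (simp add: mob_def)
    finally show ?thesis .
  qed
  have "endpoint_gain k (mob a b) - (1 / a\<^sup>2 - 1 / b\<^sup>2) / K =
     (1 / (a * (a * (K - 1) + b)) - 1 / a\<^sup>2 / K) - (1 / (b * (b * (K - 1) + a)) - 1 / b\<^sup>2 / K)"
    using 1 2 by (simp add: endpoint_gain_def K_def diff_divide_distrib)
  then show ?thesis using key[of a b] key[of b a] assms by (simp add: K_def abs_minus_commute)
qed

lemma tree_gain_mob: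
  assumes "0 < m" "m \<le> a" "m \<le> b"
  shows "\<bar>endpoint_gain 2 (transfer_pow n (mob a b)) - (1 / a\<^sup>2 - 1 / b\<^sup>2) / (real n + 2)\<bar>
    \<le> 74 * (\<bar>b - a\<bar> / m ^ 3) / (real n + 2)\<^sup>2"
proof -
  define X where "X = \<bar>b - a\<bar> / m ^ 3 / (real n + 2)\<^sup>2"
  have r: "real (n + 2) = real n + 2" by simp
  have "9 * (8 * \<bar>b - a\<bar> / m ^ 3) / (real n + 2)\<^sup>2 = 72 * X" by (simp add: X_def)
  then have "\<bar>endpoint_gain 2 (transfer_pow n (mob a b)) - endpoint_gain (n + 2) (mob a b)\<bar> \<le> 72 * X"
    using endpoint_gain_asymptotics[OF dominated_mob[OF assms], of n] by simp
  moreover have "\<bar>endpoint_gain (n + 2) (mob a b) - (1 / a\<^sup>2 - 1 / b\<^sup>2) / (real n + 2)\<bar> \<le> 2 * X"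
    using endpoint_gain_mob[OF assms, of "n + 2"] unfolding r by (simp add: X_def)
  moreover have "\<bar>p - r\<bar> \<le> \<bar>p - q\<bar> + \<bar>q - r\<bar>" for p q r :: real by linarith
  ultimately have "\<bar>endpoint_gain 2 (transfer_pow n (mob a b)) - (1 / a\<^sup>2 - 1 / b\<^sup>2) / (real n + 2)\<bar> \<le> 72 * X + 2 * X"
    by (meson add_mono order_trans)
  then show ?thesis by (simp add: X_def)
qed

lemma tree_gain_square:
  "\<bar>endpoint_gain 2 (transfer_pow n (\<lambda>x. x\<^sup>2)) + 2 / (real n + 2)\<bar> \<le> 74 / (real n + 2)\<^sup>2"
proof -
  have "endpoint_gain (n + 2) (\<lambda>x. x\<^sup>2) = - 2 / (real n + 2) + 2 / (real n + 2)\<^sup>2"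
  proof -
    have "real (n + 2) = real n + 2" by simp
    then show ?thesis unfolding endpoint_gain_def by (simp only: power2_diff power_divide) simp
  qed
  moreover have "2 / (real n + 2)\<^sup>2 = 2 * (1 / (real n + 2)\<^sup>2)" "9 * 8 / (real n + 2)\<^sup>2 = 72 * (1 / (real n + 2)\<^sup>2)"
    "74 / (real n + 2)\<^sup>2 = 74 * (1 / (real n + 2)\<^sup>2)" "- 2 / (real n + 2) = - (2 / (real n + 2))"
    "0 \<le> 1 / (real n + 2)\<^sup>2" by simp_all
  ultimately show ?thesis using endpoint_gain_asymptotics[OF dominated_square, of n] by linarith
qed

section \<open>Sums over the intervals of a level\<close>

lemma sum_lessThan_double:
  fixes f :: "nat \<Rightarrow> real"
  shows "(\<Sum>j<2 ^ Suc n. f j) = (\<Sum>j<2 ^ n. f j) + (\<Sum>j<2 ^ n. f (2 ^ n + j))"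
proof -
  have "(\<Sum>j<k + m. f j) = (\<Sum>j<k. f j) + (\<Sum>j<m. f (k + j))" for k m
    by (induction m) auto
  from this[of "2 ^ n" "2 ^ n"] show ?thesis by (simp add: mult_2)
qed

text \<open>The element \<open>sb_pt (Suc n) (Suc (2 * j))\<close> is the mediant inserted between the \<open>j\<close>-th and
  the next element of level \<open>n\<close>.\<close>

definition second_diff :: "nat \<Rightarrow> (real \<Rightarrow> real) \<Rightarrow> nat \<Rightarrow> real" where
  "second_diff n F j = 2 * F (sb_pt (Suc n) (Suc (2 * j))) - F (sb_pt n j) - F (sb_pt n (Suc j))"

definition tree_gain :: "nat \<Rightarrow> (real \<Rightarrow> real) \<Rightarrow> real" where
  "tree_gain n F = (\<Sum>j<2 ^ n. second_diff n F j)"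

definition tree_moment :: "nat \<Rightarrow> (real \<Rightarrow> real) \<Rightarrow> real" where
  "tree_moment n F = (\<Sum>j<2 ^ n. real j / 2 ^ n * second_diff n F j)"

lemma second_diff_lower:
  "j < 2 ^ n \<Longrightarrow> second_diff (Suc n) F j = second_diff n (\<lambda>x. F (sb_lo x)) j"
  by (simp add: second_diff_def sb_pt_lower)

lemma second_diff_upper:
  assumes "j < 2 ^ n"
  shows "second_diff (Suc n) F (2 ^ n + j) = second_diff n (\<lambda>x. F (sb_hi x)) j"
proof -
  have e: "Suc (2 * (2 ^ n + j)) = 2 ^ Suc n + Suc (2 * j)" "Suc (2 ^ n + j) = 2 ^ n + Suc j" by auto
  have "sb_pt (Suc (Suc n)) (Suc (2 * (2 ^ n + j))) = sb_hi (sb_pt (Suc n) (Suc (2 * j)))"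
    unfolding e(1) by (rule sb_pt_upper) (use assms in simp)
  moreover have "sb_pt (Suc n) (Suc (2 ^ n + j)) = sb_hi (sb_pt n (Suc j))"
    unfolding e(2) by (rule sb_pt_upper) (use assms in simp)
  moreover have "sb_pt (Suc n) (2 ^ n + j) = sb_hi (sb_pt n j)"
    by (rule sb_pt_upper) (use assms in simp)
  ultimately show ?thesis unfolding second_diff_def by (simp only:)
qed

lemma tree_gain_Suc: "tree_gain (Suc n) F = tree_gain n (transfer F)"
proof -
  have "tree_gain (Suc n) F =
      (\<Sum>j<2 ^ n. second_diff n (\<lambda>x. F (sb_lo x)) j) + (\<Sum>j<2 ^ n. second_diff n (\<lambda>x. F (sb_hi x)) j)"
    unfolding tree_gain_def sum_lessThan_double by (simp add: second_diff_lower second_diff_upper)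
  also have "\<dots> = tree_gain n (transfer F)"
    by (simp add: tree_gain_def sum.distrib[symmetric] second_diff_def transfer_def algebra_simps)
  finally show ?thesis .
qed

lemma tree_gain_eq: "tree_gain n F = endpoint_gain 2 (transfer_pow n F)"
proof (induction n arbitrary: F)
  case 0
  have m: "sb_pt (Suc 0) (Suc 0) = 1 / 2"
    using sb_pt_lower[of "Suc 0" 0] sb_pt_last[of 0] by (simp add: sb_lo_def)
  have e: "sb_pt 0 0 = 0" "sb_pt 0 (Suc 0) = 1"
    using sb_pt_first[of 0] sb_pt_last[of 0] by auto
  have "tree_gain 0 F = 2 * F (sb_pt (Suc 0) (Suc 0)) - F (sb_pt 0 0) - F (sb_pt 0 (Suc 0))"
    by (simp add: tree_gain_def second_diff_def)
  then show ?case unfolding m e by (simp add: endpoint_gain_def)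
next
  case (Suc n)
  then show ?case by (simp only: tree_gain_Suc transfer_pow_Suc)
qed

text \<open>The weight \<open>j/2\<^sup>n\<close> at the finer level is half the old weight on the left half and half
  of one plus the old weight on the right half.\<close>

lemma tree_moment_Suc:
  "tree_moment (Suc n) F = (tree_moment n (\<lambda>x. F (sb_lo x)) + tree_moment n (\<lambda>x. F (sb_hi x))
     + tree_gain n (\<lambda>x. F (sb_hi x))) / 2"
proof -
  have "tree_moment (Suc n) F = (\<Sum>j<2 ^ n. real j / 2 ^ Suc n * second_diff n (\<lambda>x. F (sb_lo x)) j)
     + (\<Sum>j<2 ^ n. real (2 ^ n + j) / 2 ^ Suc n * second_diff n (\<lambda>x. F (sb_hi x)) j)"
    unfolding tree_moment_def sum_lessThan_double by (simp add: second_diff_lower second_diff_upper)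
  also have "(\<Sum>j<2 ^ n. real j / 2 ^ Suc n * second_diff n (\<lambda>x. F (sb_lo x)) j) =
      tree_moment n (\<lambda>x. F (sb_lo x)) / 2"
    by (simp add: tree_moment_def sum_divide_distrib mult_ac)
  also have "(\<Sum>j<2 ^ n. real (2 ^ n + j) / 2 ^ Suc n * second_diff n (\<lambda>x. F (sb_hi x)) j) =
      (tree_gain n (\<lambda>x. F (sb_hi x)) + tree_moment n (\<lambda>x. F (sb_hi x))) / 2"
    unfolding tree_moment_def tree_gain_def sum.distrib[symmetric] sum_divide_distrib
    by (intro sum.cong refl) (simp add: field_simps)
  finally show ?thesis by simp
qed

lemma second_diff_cong:
  assumes "j < 2 ^ n" "\<And>x. x \<in> {0..1} \<Longrightarrow> F x = G x + c"
  shows "second_diff n F j = second_diff n G j"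
proof -
  have "sb_pt (Suc n) (Suc (2 * j)) \<in> {0..1}" "sb_pt n j \<in> {0..1}" "sb_pt n (Suc j) \<in> {0..1}"
    using assms(1) by (auto intro!: sb_pt_bounds simp del: atLeastAtMost_iff)
  then show ?thesis using assms(2) by (simp add: second_diff_def)
qed

lemma tree_gain_cong:
  "(\<And>x. x \<in> {0..1} \<Longrightarrow> F x = G x + c) \<Longrightarrow> tree_gain n F = tree_gain n G"
  unfolding tree_gain_def by (intro sum.cong refl second_diff_cong) auto

lemma tree_moment_cong:
  "(\<And>x. x \<in> {0..1} \<Longrightarrow> F x = G x + c) \<Longrightarrow> tree_moment n F = tree_moment n G"
  unfolding tree_moment_def by (intro sum.cong refl arg_cong2[where f = "(*)"] second_diff_cong) auto

lemma tree_moment_mob_Suc: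
  assumes "0 < a" "0 < b"
  shows "tree_moment (Suc n) (mob a b) =
    (tree_moment n (mob a (a + b)) + tree_moment n (mob (a + b) b) + tree_gain n (mob (a + b) b)) / 2"
proof -
  have "tree_moment n (\<lambda>x. mob a b (sb_lo x)) = tree_moment n (mob a (a + b))"
    by (rule tree_moment_cong[where c = 0]) (simp add: mob_lo assms)
  moreover have "tree_moment n (\<lambda>x. mob a b (sb_hi x)) = tree_moment n (mob (a + b) b)"
    by (rule tree_moment_cong) (rule mob_hi[OF assms])
  moreover have "tree_gain n (\<lambda>x. mob a b (sb_hi x)) = tree_gain n (mob (a + b) b)"
    by (rule tree_gain_cong) (rule mob_hi[OF assms])
  ultimately show ?thesis by (simp only: tree_moment_Suc)
qed

text \<open>The first term is, up to a constant, the size of \<open>mob (a + b) b\<close> in the order of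
  \<open>dominated\<close>, the second its mirror image; the multiples of \<open>1/a\<^sup>2\<close> and \<open>1/b\<^sup>2\<close> are added
  so that passing to the children multiplies the weight by less than \<open>2\<close>, against the
  factor \<open>1/2\<close> in \<open>tree_moment_mob_Suc\<close>.\<close>

definition weight :: "real \<Rightarrow> real \<Rightarrow> real" where
  "weight a b = a / b ^ 3 + b / a ^ 3 + 4 / a\<^sup>2 + 4 / b\<^sup>2"

lemma weight_children:
  assumes "0 < a" "0 < b"
  shows "weight a (a + b) + weight (a + b) b \<le> 8 / 5 * weight a b"
proof -
  define s where "s = a + b"
  have s: "s > 0" using assms by (simp add: s_def)
  have "weight a s + weight s b = (a / s ^ 3 + b / s ^ 3) + s / a ^ 3 + s / b ^ 3 + 4 / a\<^sup>2 + 4 / b\<^sup>2 + 8 / s\<^sup>2"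
    by (simp add: weight_def)
  also have "a / s ^ 3 + b / s ^ 3 = 1 / s\<^sup>2"
    using s by (simp add: add_divide_distrib[symmetric] s_def[symmetric] power2_eq_square power3_eq_cube)
  also have "s / a ^ 3 = b / a ^ 3 + 1 / a\<^sup>2"
    using assms by (simp add: s_def add_divide_distrib power2_eq_square power3_eq_cube)
  also have "s / b ^ 3 = a / b ^ 3 + 1 / b\<^sup>2"
    using assms by (simp add: s_def add_divide_distrib power2_eq_square power3_eq_cube)
  finally have e: "weight a s + weight s b = a / b ^ 3 + b / a ^ 3 + 5 / a\<^sup>2 + 5 / b\<^sup>2 + 9 / s\<^sup>2" by simp
  have "8 * (1 / s\<^sup>2) \<le> 1 / a\<^sup>2 + 1 / b\<^sup>2"
  proof -
    have "(2 * (a * b)) * (4 * (a * b)) \<le> (a\<^sup>2 + b\<^sup>2) * s\<^sup>2"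
    proof (rule mult_mono)
      show "2 * (a * b) \<le> a\<^sup>2 + b\<^sup>2" using zero_le_power2[of "a - b"] by (simp add: power2_eq_square algebra_simps)
      show "4 * (a * b) \<le> s\<^sup>2" using zero_le_power2[of "a - b"] by (simp add: s_def power2_eq_square algebra_simps)
    qed (use assms in auto)
    then have "8 * (a\<^sup>2 * b\<^sup>2) \<le> (a\<^sup>2 + b\<^sup>2) * s\<^sup>2" by (simp add: power2_eq_square mult_ac)
    then show ?thesis using assms s by (simp add: divide_simps add.commute)
  qed
  moreover define A B S X Y where "A = 1 / a\<^sup>2" and "B = 1 / b\<^sup>2" and "S = 1 / s\<^sup>2" and "X = a / b ^ 3" and "Y = b / a ^ 3"
  ultimately have "8 * S \<le> A + B" "0 \<le> A" "0 \<le> B" "0 \<le> X" "0 \<le> Y"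
    "weight a s + weight s b = X + Y + 5 * A + 5 * B + 9 * S" "weight a b = X + Y + 4 * A + 4 * B"
    using e assms by (simp_all add: weight_def)
  moreover have "5 * p \<le> 8 * q" if "8 * S \<le> A + B" "0 \<le> A" "0 \<le> B" "0 \<le> X" "0 \<le> Y"
    "p = X + Y + 5 * A + 5 * B + 9 * S" "q = X + Y + 4 * A + 4 * B" for p q :: real
    using that by linarith
  ultimately have "5 * (weight a s + weight s b) \<le> 8 * weight a b" by blast
  then show ?thesis by (simp add: s_def)
qed

lemma weight_bounds:
  assumes "0 < a" "0 < b"
  shows "a / b ^ 3 \<le> weight a b" "1 / b\<^sup>2 \<le> weight a b / 4" "0 < weight a b"
proof -
  have "0 < a / b ^ 3" "0 < b / a ^ 3" "0 < 1 / a\<^sup>2" "0 < 1 / b\<^sup>2" using assms by auto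
  moreover have "weight a b = a / b ^ 3 + b / a ^ 3 + 4 * (1 / a\<^sup>2) + 4 * (1 / b\<^sup>2)" by (simp add: weight_def)
  ultimately show "a / b ^ 3 \<le> weight a b" "1 / b\<^sup>2 \<le> weight a b / 4" "0 < weight a b" by linarith+
qed

text \<open>The main term \<open>-1/(b\<^sup>2 K)\<close> is reproduced by the recursion up to replacing \<open>K\<close> by \<open>K +
  1\<close>, because the contributions of the new endpoint with denominator \<open>a + b\<close> cancel. The
  errors contract by the factor \<open>4/5\<close> of \<open>weight_children\<close>. The shift by \<open>20\<close> makes the
  loss \<open>((n + 21)/(n + 20))\<^sup>2\<close> small enough, already for \<open>n = 0\<close>, to be absorbed by this
  contraction.\<close>

lemma tree_moment_mob:
  assumes "0 < a" "0 < b"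
  shows "\<bar>tree_moment n (mob a b) + 1 / b\<^sup>2 / (real n + 2)\<bar> \<le> 40000 * weight a b / (real n + 20)\<^sup>2"
  using assms
proof (induction n arbitrary: a b)
  case 0
  then show ?case using weight_bounds[of a b] by (simp add: tree_moment_def power2_eq_square)
next
  case (Suc n)
  define s where "s = a + b"
  define W where "W = weight a b"
  define K where "K = real n + 2"
  define R where "R = (real n + 20)\<^sup>2"
  have s: "0 < s" "b \<le> s" using Suc.prems by (auto simp: s_def)
  have K: "K \<ge> 2" by (simp add: K_def)
  have W: "a / b ^ 3 \<le> W" "1 / b\<^sup>2 \<le> W / 4" "0 < W" using weight_bounds[OF Suc.prems] by (auto simp: W_def)
  have R: "R > 0" unfolding R_def by (intro zero_less_power) simp
  have KR: "R / 100 \<le> K\<^sup>2"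
  proof -
    \<comment> \<open>The factor \<open>10\<close> is what \<open>n = 0\<close> requires.\<close>
    have "(real n + 20)\<^sup>2 \<le> (10 * K)\<^sup>2" by (intro power_mono) (auto simp: K_def)
    then show ?thesis by (simp add: R_def power_mult_distrib)
  qed
  have 1: "\<bar>tree_moment n (mob a s) + 1 / s\<^sup>2 / K\<bar> \<le> 40000 * weight a s / R"
    unfolding K_def R_def by (rule Suc.IH) (use Suc.prems s in auto)
  have 2: "\<bar>tree_moment n (mob s b) + 1 / b\<^sup>2 / K\<bar> \<le> 40000 * weight s b / R"
    unfolding K_def R_def by (rule Suc.IH) (use Suc.prems s in auto)
  have 3: "\<bar>tree_gain n (mob s b) - (1 / s\<^sup>2 - 1 / b\<^sup>2) / K\<bar> \<le> 74 * (a / b ^ 3) / K\<^sup>2"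
    using tree_gain_mob[of b s b n] s Suc.prems by (simp add: tree_gain_eq K_def s_def)
  have "74 * (a / b ^ 3) / K\<^sup>2 \<le> 74 * W / (R / 100)"
    using W R KR K Suc.prems by (intro frac_le mult_left_mono) auto
  then have 3: "\<bar>tree_gain n (mob s b) - (1 / s\<^sup>2 - 1 / b\<^sup>2) / K\<bar> \<le> 7400 * (W / R)"
    using 3 by simp
  have 4: "\<bar>1 / b\<^sup>2 / (K + 1) - 1 / b\<^sup>2 / K\<bar> \<le> 25 * (W / R)"
  proof -
    have "1 / b\<^sup>2 / (K + 1) - 1 / b\<^sup>2 / K = - (1 / b\<^sup>2 * (1 / ((K + 1) * K)))"
      using K Suc.prems by (simp add: divide_simps)
    then have "\<bar>1 / b\<^sup>2 / (K + 1) - 1 / b\<^sup>2 / K\<bar> = 1 / b\<^sup>2 * (1 / ((K + 1) * K))"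
      using K by (simp add: abs_mult)
    also have "\<dots> \<le> W / 4 * (1 / (R / 100))"
    proof (rule mult_mono)
      have "K\<^sup>2 \<le> (K + 1) * K" using K by (simp add: power2_eq_square algebra_simps)
      then show "1 / ((K + 1) * K) \<le> 1 / (R / 100)" using KR R K by (intro divide_left_mono mult_pos_pos) auto
    qed (use W K in auto)
    also have "\<dots> = 25 * (W / R)" by simp
    finally show ?thesis .
  qed
  have 5: "40000 * weight a s / R + 40000 * weight s b / R \<le> 64000 * (W / R)"
  proof -
    have "(weight a s + weight s b) / R \<le> 8 / 5 * W / R"
      using weight_children[OF Suc.prems] R by (intro divide_right_mono) (auto simp: s_def W_def)
    then show ?thesis by (simp add: add_divide_distrib)
  qed
  have rec: "tree_moment (Suc n) (mob a b) =
      (tree_moment n (mob a s) + tree_moment n (mob s b) + tree_gain n (mob s b)) / 2"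
    unfolding s_def by (rule tree_moment_mob_Suc) (use Suc.prems in auto)
  have diff: "(1 / s\<^sup>2 - 1 / b\<^sup>2) / K = 1 / s\<^sup>2 / K - 1 / b\<^sup>2 / K" by (simp add: diff_divide_distrib)
  \<comment> \<open>The errors of the two children, of the unweighted sum and of the shift of \<open>K\<close> add up.\<close>
  have combine: "\<bar>(t + t' + g) / 2 + v'\<bar> \<le> 36000 * Z"
    if "\<bar>t + u\<bar> \<le> p" "\<bar>t' + v\<bar> \<le> p'" "\<bar>g - (u - v)\<bar> \<le> 7400 * Z" "\<bar>v' - v\<bar> \<le> 25 * Z"
      "p + p' \<le> 64000 * Z" "0 \<le> Z" for t t' g u v v' p p' Z :: real
    using that by (simp add: abs_le_iff field_simps)
  have "\<bar>tree_moment (Suc n) (mob a b) + 1 / b\<^sup>2 / (K + 1)\<bar> \<le> 36000 * (W / R)"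
    unfolding rec by (rule combine[OF 1 2 3[unfolded diff] 4 5]) (use W R in simp)
  also have "36000 * (W / R) \<le> 40000 * W / (real (Suc n) + 20)\<^sup>2"
  proof -
    have "20 * (real (Suc n) + 20) \<le> 21 * (real n + 20)" by simp
    then have "(20 * (real (Suc n) + 20))\<^sup>2 \<le> (21 * (real n + 20))\<^sup>2" by (intro power_mono) auto
    then have "400 * (real (Suc n) + 20)\<^sup>2 \<le> 441 * R" by (simp only: power_mult_distrib R_def) simp
    then have "36000 * (real (Suc n) + 20)\<^sup>2 \<le> 40000 * R" using R by linarith
    then have "36000 * (real (Suc n) + 20)\<^sup>2 * W \<le> 40000 * R * W" using W by (intro mult_right_mono) auto
    then show ?thesis using R by (simp add: divide_simps mult_ac) 
  qed
  finally show ?case by (simp add: K_def W_def add.commute add.left_commute)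
qed

lemma tree_moment_ident:
  "\<bar>tree_moment n (\<lambda>x. x) + 1 / (real n + 2)\<bar> \<le> 400000 / (real n + 2)\<^sup>2"
proof -
  have "tree_moment n (\<lambda>x. x) = tree_moment n (mob 1 1)" by (simp add: mob_def[abs_def])
  then have "\<bar>tree_moment n (\<lambda>x. x) + 1 / (real n + 2)\<bar> \<le> 400000 / (real n + 20)\<^sup>2"
    using tree_moment_mob[of 1 1 n] by (simp add: weight_def)
  also have "\<dots> \<le> 400000 / (real n + 2)\<^sup>2" by (intro divide_left_mono power_mono) auto
  finally show ?thesis .
qed

section \<open>Doubling the deviation\<close>

definition deviation :: "nat \<Rightarrow> real" where
  "deviation n = (\<Sum>j = 1..2 ^ n. (sb_pt n j - real j / 2 ^ n)\<^sup>2)"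

text \<open>The two end terms vanish, so the sum may run over the left or over the right endpoints
  of the intervals.\<close>

lemma deviation_lessThan:
  "deviation n = (\<Sum>j<2 ^ n. (sb_pt n j - real j / 2 ^ n)\<^sup>2)"
  "deviation n = (\<Sum>j<2 ^ n. (sb_pt n (Suc j) - real (Suc j) / 2 ^ n)\<^sup>2)"
proof -
  let ?g = "\<lambda>j. (sb_pt n j - real j / 2 ^ n)\<^sup>2"
  show 2: "deviation n = (\<Sum>j<2 ^ n. ?g (Suc j))"
    unfolding deviation_def by (simp add: sum.atLeast1_atMost_eq)
  have "(\<Sum>j<2 ^ n. ?g j) + ?g (2 ^ n) = ?g 0 + (\<Sum>j<2 ^ n. ?g (Suc j))"
    using sum.lessThan_Suc[of ?g "2 ^ n"] sum.lessThan_Suc_shift[of ?g "2 ^ n"] by simp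
  then show "deviation n = (\<Sum>j<2 ^ n. ?g j)" unfolding 2 by (simp add: sb_pt_first sb_pt_last)
qed

lemma sum_lessThan_even_odd:
  fixes f :: "nat \<Rightarrow> real"
  shows "(\<Sum>j<2 * m. f j) = (\<Sum>j<m. f (2 * j) + f (Suc (2 * j)))"
  by (induction m) (auto simp: algebra_simps)

text \<open>With \<open>t\<close>, \<open>t + d\<close>, \<open>t + 2d\<close> the parameters of the left endpoint, of the mediant and
  of the right endpoint of an interval, the claim for the contribution of this interval is
  an identity between polynomials.\<close>

lemma deviation_Suc_diff:
  "2 * (deviation (Suc n) - 2 * deviation n) =
     tree_gain n (\<lambda>x. x\<^sup>2) - 2 * tree_moment n (\<lambda>x. x)
     + (2 * (\<Sum>j<2 ^ n. sb_pt n (Suc j) - sb_pt (Suc n) (Suc (2 * j))) - 1 / 2) / 2 ^ n"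
proof -
  define N :: real where "N = 2 ^ n"
  have N: "N > 0" by (simp add: N_def)
  let ?x = "\<lambda>j. sb_pt n j" and ?y = "\<lambda>j. sb_pt (Suc n) (Suc (2 * j))"
  have "deviation (Suc n) = (\<Sum>j<2 ^ n. (sb_pt (Suc n) (2 * j) - real (2 * j) / 2 ^ Suc n)\<^sup>2
      + (?y j - real (Suc (2 * j)) / 2 ^ Suc n)\<^sup>2)"
    using sum_lessThan_even_odd[of _ "2 ^ n"] by (simp add: deviation_lessThan(1))
  also have "\<dots> = (\<Sum>j<2 ^ n. (?x j - real j / N)\<^sup>2 + (?y j - (real j / N + 1 / (2 * N)))\<^sup>2)"
  proof (intro sum.cong refl)
    fix j assume "j \<in> {..<2 ^ n::nat}"
    then have "sb_pt (Suc n) (2 * j) = ?x j" by (simp add: sb_pt_even)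
    moreover have "real (2 * j) / 2 ^ Suc n = real j / N" "real (Suc (2 * j)) / 2 ^ Suc n = real j / N + 1 / (2 * N)"
      by (simp_all add: N_def field_simps)
    ultimately show "(sb_pt (Suc n) (2 * j) - real (2 * j) / 2 ^ Suc n)\<^sup>2 + (?y j - real (Suc (2 * j)) / 2 ^ Suc n)\<^sup>2 =
        (?x j - real j / N)\<^sup>2 + (?y j - (real j / N + 1 / (2 * N)))\<^sup>2" by (simp only:)
  qed
  finally have S: "deviation (Suc n) = deviation n + (\<Sum>j<2 ^ n. (?y j - (real j / N + 1 / (2 * N)))\<^sup>2)"
    by (simp add: sum.distrib deviation_lessThan(1) N_def)
  have "2 * (deviation (Suc n) - 2 * deviation n) =
      2 * (\<Sum>j<2 ^ n. (?y j - (real j / N + 1 / (2 * N)))\<^sup>2)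
       - (\<Sum>j<2 ^ n. (?x j - real j / N)\<^sup>2) - (\<Sum>j<2 ^ n. (?x (Suc j) - real (Suc j) / N)\<^sup>2)"
    using S deviation_lessThan[of n] by (simp add: N_def)
  also have "\<dots> = (\<Sum>j<2 ^ n. 2 * (?y j - (real j / N + 1 / (2 * N)))\<^sup>2
       - (?x j - real j / N)\<^sup>2 - (?x (Suc j) - real (Suc j) / N)\<^sup>2)"
    by (simp only: sum_distrib_left sum_subtractf)
  also have "\<dots> = (\<Sum>j<2 ^ n. second_diff n (\<lambda>x. x\<^sup>2) j - 2 * (real j / 2 ^ n * second_diff n (\<lambda>x. x) j)
       + (2 / N * (?x (Suc j) - ?y j) - 1 / (2 * N\<^sup>2)))"
  proof (intro sum.cong refl)
    fix j
    define t d where "t = real j / N" and "d = 1 / (2 * N)"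
    have t: "real j / 2 ^ n = t" "real (Suc j) / N = t + 2 * d" "2 / N = 4 * d" "1 / (2 * N\<^sup>2) = 2 * d\<^sup>2"
      using N by (auto simp: t_def d_def N_def field_simps power2_eq_square)
    show "2 * (?y j - (real j / N + 1 / (2 * N)))\<^sup>2
       - (?x j - real j / N)\<^sup>2 - (?x (Suc j) - real (Suc j) / N)\<^sup>2 =
       second_diff n (\<lambda>x. x\<^sup>2) j - 2 * (real j / 2 ^ n * second_diff n (\<lambda>x. x) j)
       + (2 / N * (?x (Suc j) - ?y j) - 1 / (2 * N\<^sup>2))"
      unfolding t t_def[symmetric] d_def[symmetric] second_diff_def
      by (simp add: power2_eq_square algebra_simps)
  qed
  also have "\<dots> = tree_gain n (\<lambda>x. x\<^sup>2) - 2 * tree_moment n (\<lambda>x. x)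
      + (2 / N * (\<Sum>j<2 ^ n. ?x (Suc j) - ?y j) - 2 ^ n * (1 / (2 * N\<^sup>2)))"
  proof -
    have "(\<Sum>j<2 ^ n. A j - 2 * B j + (c * g j - d)) =
        (\<Sum>j<2 ^ n. A j) - 2 * (\<Sum>j<2 ^ n. B j) + (c * (\<Sum>j<2 ^ n. g j) - 2 ^ n * d)"
      for A B g :: "nat \<Rightarrow> real" and c d
      by (simp add: sum.distrib sum_subtractf sum_distrib_left)
    then show ?thesis unfolding tree_gain_def tree_moment_def .
  qed
  also have "2 ^ n * (1 / (2 * N\<^sup>2)) = 1 / 2 / N" using N by (simp add: N_def power2_eq_square)
  finally show ?thesis by (simp add: N_def diff_divide_distrib)
qed

lemma sb_gap_sum_bounds:
  "(\<Sum>j<2 ^ n. sb_pt n (Suc j) - sb_pt (Suc n) (Suc (2 * j))) \<in> {0..1}"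
proof -
  have "0 \<le> sb_pt n (Suc j) - sb_pt (Suc n) (Suc (2 * j)) \<and>
      sb_pt n (Suc j) - sb_pt (Suc n) (Suc (2 * j)) \<le> sb_pt n (Suc j) - sb_pt n j" if "j < 2 ^ n" for j
    using sb_pt_strict_mono[of "Suc (2 * j)" "2 * Suc j" "Suc n"] sb_pt_strict_mono[of "2 * j" "Suc (2 * j)" "Suc n"]
      sb_pt_even[of j n] sb_pt_even[of "Suc j" n] that by simp
  moreover have "(\<Sum>j<2 ^ n. sb_pt n (Suc j) - sb_pt n j) = 1"
    by (simp add: sum_lessThan_telescope sb_pt_first sb_pt_last)
  ultimately show ?thesis
    using sum_mono[of "{..<2 ^ n}" "\<lambda>j. sb_pt n (Suc j) - sb_pt (Suc n) (Suc (2 * j))" "\<lambda>j. sb_pt n (Suc j) - sb_pt n j"]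
    by (auto intro!: sum_nonneg simp del: sum_subtractf)
qed

lemma square_le_power2: "(real n + 2)\<^sup>2 \<le> 8 * 2 ^ n"
proof (induction n)
  case (Suc n)
  show ?case
  proof (cases "n = 0")
    case False
    then have "1 \<le> real n" "0 \<le> real n * real n" by auto
    moreover have "2 * (real n + 2)\<^sup>2 - (real (Suc n) + 2)\<^sup>2 = real n * real n + 2 * real n - 1"
      by (simp add: power2_eq_square algebra_simps)
    ultimately have "(real (Suc n) + 2)\<^sup>2 \<le> 2 * (real n + 2)\<^sup>2" by linarith
    then show ?thesis using Suc.IH by simp
  qed simp
qed simp

text \<open>Here the terms \<open>-2/(n+2)\<close> of \<open>tree_gain\<close> and \<open>-1/(n+2)\<close> of \<open>tree_moment\<close> cancel.\<close>

lemma deviation_doubling_defect: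
  "\<bar>deviation (Suc n) - 2 * deviation n\<bar> \<le> 400045 / (real n + 2)\<^sup>2"
proof -
  define Q where "Q = 1 / (real n + 2)\<^sup>2"
  define H where "H = 1 / (real n + 2)"
  define G where "G = (\<Sum>j<2 ^ n. sb_pt n (Suc j) - sb_pt (Suc n) (Suc (2 * j)))"
  have "\<bar>2 * G - 1 / 2\<bar> \<le> 2" using sb_gap_sum_bounds[of n] by (auto simp: G_def)
  then have "\<bar>(2 * G - 1 / 2) / 2 ^ n\<bar> \<le> 2 / 2 ^ n" by (simp add: abs_divide divide_right_mono)
  also have "\<dots> \<le> 16 * Q"
    using square_le_power2[of n] by (simp add: Q_def divide_simps)
  finally have 1: "\<bar>(2 * G - 1 / 2) / 2 ^ n\<bar> \<le> 16 * Q" .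
  have 2: "\<bar>tree_gain n (\<lambda>x. x\<^sup>2) + 2 * H\<bar> \<le> 74 * Q"
    using tree_gain_square[of n] by (simp add: tree_gain_eq Q_def H_def)
  have 3: "\<bar>tree_moment n (\<lambda>x. x) + H\<bar> \<le> 400000 * Q"
    using tree_moment_ident[of n] by (simp add: Q_def H_def)
  have "\<bar>deviation (Suc n) - 2 * deviation n\<bar> \<le> 400045 * Q"
  proof -
    define D where "D = (2 * G - 1 / 2) / 2 ^ n"
    have "2 * (deviation (Suc n) - 2 * deviation n) = tree_gain n (\<lambda>x. x\<^sup>2) - 2 * tree_moment n (\<lambda>x. x) + D"
      unfolding D_def G_def by (rule deviation_Suc_diff)
    moreover have "\<bar>d\<bar> \<le> 400045 * Q"
      if "2 * d = t - 2 * m + D" "\<bar>D\<bar> \<le> 16 * Q" "\<bar>t + 2 * H\<bar> \<le> 74 * Q" "\<bar>m + H\<bar> \<le> 400000 * Q"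
      for d t m :: real using that by linarith
    ultimately show ?thesis using 1 2 3 unfolding D_def[symmetric] by blast
  qed
  then show ?thesis by (simp add: Q_def)
qed

text \<open>Doubling is expanding, so the recurrence is solved backwards: \<open>|e\<^sub>n| \<le> (|e\<^sub>n\<^sub>+\<^sub>1| +
  r\<^sub>n)/2\<close>, and the bound \<open>B\<close> at a far index is divided by a high power of \<open>2\<close>.\<close>

lemma bounded_doubling_recurrence:
  fixes e r :: "nat \<Rightarrow> real"
  assumes defect: "\<And>n. \<bar>e (Suc n) - 2 * e n\<bar> \<le> r n" and r: "antimono r" and bd: "\<And>n. \<bar>e n\<bar> \<le> B"
  shows "\<bar>e n\<bar> \<le> r n"
proof -
  have "\<bar>e n\<bar> \<le> B / 2 ^ k + r n" for k n
  proof (induction k arbitrary: n)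
    case 0
    have "0 \<le> r n" using defect[of n] by linarith
    then show ?case using bd[of n] by simp
  next
    case (Suc k)
    have "2 * \<bar>e n\<bar> \<le> \<bar>e (Suc n)\<bar> + r n" using defect[of n] by linarith
    also have "\<dots> \<le> B / 2 ^ k + r (Suc n) + r n" using Suc.IH[of "Suc n"] by simp
    also have "r (Suc n) \<le> r n" using r by (simp add: antimonoD)
    finally show ?case by (simp add: field_simps)
  qed
  moreover have "(\<lambda>k. B / 2 ^ k + r n) \<longlonglongrightarrow> 0 + r n"
    by (intro tendsto_intros LIMSEQ_divide_realpow_zero) auto
  ultimately show ?thesis by (intro LIMSEQ_le_const[of "\<lambda>k. B / 2 ^ k + r n"]) auto
qed

section \<open>The question mark function and its integral\<close>

lemma sb_pt_refine: "j \<le> 2 ^ n \<Longrightarrow> sb_pt (n + k) (j * 2 ^ k) = sb_pt n j"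
proof (induction k)
  case (Suc k)
  then have "j * 2 ^ k \<le> 2 ^ (n + k)" by (simp add: power_add)
  then show ?case using sb_pt_even[of "j * 2 ^ k" "n + k"] Suc by (simp add: mult_ac)
qed simp

lemma sb_pt_mono: "i \<le> j \<Longrightarrow> j \<le> 2 ^ n \<Longrightarrow> sb_pt n i \<le> sb_pt n j"
  using sb_pt_strict_mono[of i j n] by (cases "i = j") auto

definition sb_count :: "nat \<Rightarrow> real \<Rightarrow> nat" where
  "sb_count n x = card (real_of_rat ` stern_brocot n \<inter> {0..<x})"

lemma sb_count_eq: "sb_count n x = card {j. j \<le> 2 ^ n \<and> sb_pt n j < x}"
proof -
  have "real_of_rat ` stern_brocot n = sb_pt n ` {..2 ^ n}"
    unfolding stern_brocot_eq image_image by (intro image_cong refl) (simp add: of_rat_sb_rat)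
  then have "real_of_rat ` stern_brocot n \<inter> {0..<x} = sb_pt n ` {j. j \<le> 2 ^ n \<and> sb_pt n j < x}"
    using sb_pt_bounds by fastforce
  moreover have "inj_on (sb_pt n) {j. j \<le> 2 ^ n \<and> sb_pt n j < x}"
    by (rule linorder_inj_onI) (use sb_pt_strict_mono in fastforce)+
  ultimately show ?thesis by (simp add: sb_count_def card_image)
qed

text \<open>At level \<open>n + k\<close> the endpoints of the \<open>j\<close>-th interval of level \<open>n\<close> have the indices \<open>j
  2\<^sup>k\<close> and \<open>(j+1) 2\<^sup>k\<close>.\<close>

lemma sb_count_bounds:
  assumes j: "j < 2 ^ n" and x: "sb_pt n j \<le> x" "x \<le> sb_pt n (Suc j)"
  shows "j * 2 ^ k \<le> sb_count (n + k) x" "sb_count (n + k) x \<le> Suc j * 2 ^ k"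
proof -
  let ?m = "n + k"
  have le: "j * 2 ^ k \<le> 2 ^ ?m" "Suc j * 2 ^ k \<le> 2 ^ ?m"
    using j mult_le_mono1[of "Suc j" "2 ^ n" "2 ^ k"] mult_le_mono1[of j "2 ^ n" "2 ^ k"] by (auto simp: power_add)
  have "{..<j * 2 ^ k} \<subseteq> {i. i \<le> 2 ^ ?m \<and> sb_pt ?m i < x}"
  proof
    fix i assume "i \<in> {..<j * 2 ^ k}"
    then show "i \<in> {i. i \<le> 2 ^ ?m \<and> sb_pt ?m i < x}"
      using sb_pt_strict_mono[of i "j * 2 ^ k" ?m] sb_pt_refine[of j n k] j x le by auto
  qed
  then have "card {..<j * 2 ^ k} \<le> sb_count ?m x" unfolding sb_count_eq by (intro card_mono) auto
  then show "j * 2 ^ k \<le> sb_count ?m x" by simp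
  have "{i. i \<le> 2 ^ ?m \<and> sb_pt ?m i < x} \<subseteq> {..<Suc j * 2 ^ k}"
  proof
    fix i assume i: "i \<in> {i. i \<le> 2 ^ ?m \<and> sb_pt ?m i < x}"
    have "\<not> Suc j * 2 ^ k \<le> i"
    proof
      assume "Suc j * 2 ^ k \<le> i"
      then have "sb_pt n (Suc j) \<le> sb_pt ?m i"
        using sb_pt_mono[of "Suc j * 2 ^ k" i ?m] sb_pt_refine[of "Suc j" n k] j i by auto
      then show False using i x by auto
    qed
    then show "i \<in> {..<Suc j * 2 ^ k}" by auto
  qed
  then have "sb_count ?m x \<le> card {..<Suc j * 2 ^ k}" unfolding sb_count_eq by (intro card_mono) auto
  then show "sb_count ?m x \<le> Suc j * 2 ^ k" by simp
qed

lemma sb_count_ratio_bounds: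
  assumes "j < 2 ^ n" "sb_pt n j \<le> x" "x \<le> sb_pt n (Suc j)"
  defines "u \<equiv> \<lambda>m. real (sb_count m x) / (2 ^ m + 1)"
  shows "real j / 2 ^ n * (1 - 1 / 2 ^ (n + k)) \<le> u (n + k)" "u (n + k) \<le> real (Suc j) / 2 ^ n"
proof -
  let ?M = "2 ^ (n + k) :: real"
  have M: "?M > 0" "?M = 2 ^ n * 2 ^ k" by (auto simp: power_add)
  note b = sb_count_bounds[OF assms(1-3), of k]
  have "real (j * 2 ^ k) \<le> real (sb_count (n + k) x)" using b(1) by (simp only: of_nat_le_iff)
  then have lo: "real j / 2 ^ n * ?M \<le> real (sb_count (n + k) x)" using M by simp
  have "1 - 1 / ?M \<le> ?M / (?M + 1)"
  proof (subst pos_le_divide_eq)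
    show "(1 - 1 / ?M) * (?M + 1) \<le> ?M" using M(1) by (simp add: algebra_simps)
  qed (simp add: add_pos_pos)
  then have "real j / 2 ^ n * (1 - 1 / ?M) \<le> real j / 2 ^ n * (?M / (?M + 1))" by (intro mult_left_mono) auto
  also have "\<dots> = real j / 2 ^ n * ?M / (?M + 1)" by simp
  also have "\<dots> \<le> u (n + k)" unfolding u_def using lo by (intro divide_right_mono) auto
  finally show "real j / 2 ^ n * (1 - 1 / ?M) \<le> u (n + k)" .
  have "real (sb_count (n + k) x) \<le> real (Suc j * 2 ^ k)" using b(2) by (simp only: of_nat_le_iff)
  also have "real (Suc j * 2 ^ k) = real (Suc j) / 2 ^ n * ?M" using M(2) by (simp add: distrib_right add_divide_distrib)
  also have "\<dots> \<le> real (Suc j) / 2 ^ n * (?M + 1)" by (intro mult_left_mono) auto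
  finally show "u (n + k) \<le> real (Suc j) / 2 ^ n" unfolding u_def by (subst pos_divide_le_eq) (simp_all add: add_pos_pos)
qed

lemma sb_interval_exists:
  assumes "x \<in> {0..1}"
  obtains j where "j < 2 ^ n" "sb_pt n j \<le> x" "x \<le> sb_pt n (Suc j)"
proof -
  have *: "\<exists>j<2 ^ n. sb_pt n j \<le> x \<and> x \<le> sb_pt n (Suc j)" if "m \<le> 2 ^ n" "x \<le> sb_pt n m" "0 < m" for m
    using that
  proof (induction m)
    case (Suc m)
    show ?case
    proof (cases "sb_pt n m \<le> x")
      case False
      then have "m \<noteq> 0" using assms sb_pt_first[of n] by (cases "m = 0") auto
      then show ?thesis using Suc False by auto
    next
      case True
      then show ?thesis using Suc.prems by (intro exI[of _ m]) auto
    qed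
  qed simp
  have "\<exists>j<2 ^ n. sb_pt n j \<le> x \<and> x \<le> sb_pt n (Suc j)"
    by (rule *[of "2 ^ n"]) (use assms sb_pt_last[of n] in auto)
  then show ?thesis using that by blast
qed

text \<open>The interval of level \<open>n\<close> around \<open>x\<close> confines all later ratios to an interval of length
  \<open>2/2\<^sup>n\<close>.\<close>

lemma question_mark_convergent:
  assumes "x \<in> {0..1}"
  shows "convergent (\<lambda>m. real (sb_count m x) / (2 ^ m + 1))"
proof -
  let ?u = "\<lambda>m. real (sb_count m x) / (2 ^ m + 1)"
  have "Cauchy ?u"
  proof (rule metric_CauchyI)
    fix e :: real assume e: "e > 0"
    obtain n where n: "(1 / 2) ^ n < e / 2" 
      using real_arch_pow_inv[of "e / 2" "1 / 2"] e by force
    obtain j where j: "j < 2 ^ n" "sb_pt n j \<le> x" "x \<le> sb_pt n (Suc j)"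
      using sb_interval_exists[OF assms, of n] by blast
    have mem: "?u m \<in> {real j / 2 ^ n - 1 / 2 ^ n .. real j / 2 ^ n + 1 / 2 ^ n}" if le: "m \<ge> n" for m
    proof -
      obtain k where k: "m = n + k" using le le_Suc_ex by blast
      have "1 / 2 ^ (n + k) \<le> (1 :: real) / 2 ^ n" by (simp add: power_add divide_simps)
      moreover have "real j / 2 ^ n \<le> 1" using j(1) by (simp add: divide_simps)
      then have "real j / 2 ^ n * (1 / 2 ^ (n + k)) \<le> 1 * (1 / 2 ^ (n + k))" by (intro mult_right_mono) auto
      ultimately have "real j / 2 ^ n - 1 / 2 ^ n \<le> real j / 2 ^ n * (1 - 1 / 2 ^ (n + k))"
        by (simp add: right_diff_distrib)
      then show ?thesis using sb_count_ratio_bounds[OF j, of k] unfolding k by (auto simp: add_divide_distrib)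
    qed
    have "dist (?u a) (?u b) < e" if "a \<ge> n" "b \<ge> n" for a b
    proof -
      have "\<bar>?u a - ?u b\<bar> \<le> 2 * (1 / 2 ^ n)" using mem[OF that(1)] mem[OF that(2)] by auto
      then show ?thesis using n by (simp add: dist_real_def power_one_over)
    qed
    then show "\<exists>M. \<forall>m\<ge>M. \<forall>n\<ge>M. dist (?u m) (?u n) < e" by blast
  qed
  then show ?thesis by (simp add: real_Cauchy_convergent)
qed

lemma question_mark_LIMSEQ:
  assumes "x \<in> {0..1}"
  shows "(\<lambda>m. real (sb_count m x) / (2 ^ m + 1)) \<longlonglongrightarrow> question_mark x"
  using question_mark_convergent[OF assms] unfolding convergent_LIMSEQ_iff question_mark_def sb_count_def .

lemma question_mark_bounds:
  assumes "j < 2 ^ n" "sb_pt n j \<le> x" "x \<le> sb_pt n (Suc j)"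
  shows "question_mark x \<in> {real j / 2 ^ n .. real (Suc j) / 2 ^ n}"
proof -
  let ?u = "\<lambda>m. real (sb_count m x) / (2 ^ m + 1)"
  have "x \<in> {0..1}" using assms sb_pt_bounds[of j n] sb_pt_bounds[of "Suc j" n] by auto
  then have lim: "(\<lambda>k. ?u (n + k)) \<longlonglongrightarrow> question_mark x"
    using LIMSEQ_ignore_initial_segment[OF question_mark_LIMSEQ, of x n] by (simp add: add.commute)
  have "(\<lambda>m. 1 / 2 ^ m :: real) \<longlonglongrightarrow> 0" by (rule LIMSEQ_divide_realpow_zero) simp
  then have "(\<lambda>k. 1 / 2 ^ (n + k) :: real) \<longlonglongrightarrow> 0"
    using LIMSEQ_ignore_initial_segment[of "\<lambda>m. 1 / 2 ^ m :: real" 0 n] by (simp add: add.commute)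
  then have "(\<lambda>k. real j / 2 ^ n * (1 - 1 / 2 ^ (n + k))) \<longlonglongrightarrow> real j / 2 ^ n * (1 - 0)"
    by (intro tendsto_intros)
  then have "real j / 2 ^ n * (1 - 0) \<le> question_mark x"
    by (rule LIMSEQ_le[OF _ lim]) (use sb_count_ratio_bounds(1)[OF assms] in blast)
  moreover have "question_mark x \<le> real (Suc j) / 2 ^ n"
    by (rule LIMSEQ_le_const2[OF lim]) (use sb_count_ratio_bounds(2)[OF assms] in blast)
  ultimately show ?thesis by simp
qed

lemma question_mark_mono: "mono_on {0..1} question_mark"
proof (rule mono_onI)
  fix x y :: real assume xy: "x \<in> {0..1}" "y \<in> {0..1}" "x \<le> y"
  have "sb_count m x \<le> sb_count m y" for m
    unfolding sb_count_eq using xy by (intro card_mono) auto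
  then show "question_mark x \<le> question_mark y"
    by (intro LIMSEQ_le[OF question_mark_LIMSEQ question_mark_LIMSEQ] xy) (auto intro!: divide_right_mono)
qed

lemma question_mark_unit: "x \<in> {0..1} \<Longrightarrow> question_mark x \<in> {0..1}"
  using sb_interval_exists[of x 0] question_mark_bounds[of _ 0 x] by auto

text \<open>Expanding the square leaves products of non-negative increasing functions, which are
  integrable.\<close>

lemma question_mark_integrable: "(\<lambda>x. (question_mark x - x)\<^sup>2) integrable_on {0..1}"
proof -
  have m: "mono_on {0..1} (\<lambda>x. question_mark x * question_mark x)" "mono_on {0..1} (\<lambda>x. question_mark x * x)"
    using question_mark_mono question_mark_unit by (auto intro!: mono_onI mult_mono simp: mono_on_def)
  have "(\<lambda>x. question_mark x * question_mark x - 2 * (question_mark x * x) + x\<^sup>2) integrable_on {0..1}"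
    by (intro integrable_add integrable_diff integrable_on_mult_right integrable_on_mono_on m integrable_continuous_interval continuous_intros)
  then show ?thesis by (simp add: power2_eq_square algebra_simps)
qed

text \<open>On the \<open>j\<close>-th interval the question mark function differs from its left value \<open>t\<close> by at
  most \<open>1/2\<^sup>n\<close>.\<close>

lemma integral_question_mark_piece:
  assumes j: "j < 2 ^ n"
  defines "p \<equiv> sb_pt n j" and "q \<equiv> sb_pt n (Suc j)" and "t \<equiv> real j / 2 ^ n"
  shows "\<bar>integral {p..q} (\<lambda>x. (question_mark x - x)\<^sup>2) - ((q - t) ^ 3 - (p - t) ^ 3) / 3\<bar> \<le> 2 / 2 ^ n * (q - p)"
proof -
  have pq: "p \<le> q" unfolding p_def q_def using sb_pt_strict_mono[of j "Suc j" n] j by simp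
  have sub: "{p..q} \<subseteq> {0..1}" using sb_pt_bounds[of j n] sb_pt_bounds[of "Suc j" n] j by (auto simp: p_def q_def)
  have int: "(\<lambda>x. (question_mark x - x)\<^sup>2) integrable_on {p..q}"
    by (rule integrable_on_subinterval[OF question_mark_integrable sub])
  have ftc: "((\<lambda>x. (x - t)\<^sup>2) has_integral ((q - t) ^ 3 / 3 - (p - t) ^ 3 / 3)) {p..q}"
    by (rule fundamental_theorem_of_calculus[OF pq])
       (auto intro!: derivative_eq_intros simp flip: has_real_derivative_iff_has_vector_derivative)
  have "norm (integral {p..q} (\<lambda>x. (question_mark x - x)\<^sup>2 - (x - t)\<^sup>2)) \<le> integral {p..q} (\<lambda>x. 2 / 2 ^ n)"
  proof (rule integral_norm_bound_integral)
    show "(\<lambda>x. (question_mark x - x)\<^sup>2 - (x - t)\<^sup>2) integrable_on {p..q}"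
      by (intro integrable_diff int has_integral_integrable[OF ftc])
    fix x assume x: "x \<in> {p..q}"
    have 1: "\<bar>question_mark x - t\<bar> \<le> 1 / 2 ^ n"
      using question_mark_bounds[OF j, of x] x by (auto simp: p_def q_def t_def add_divide_distrib)
    have t: "t \<in> {0..1}" using j by (simp add: t_def divide_simps)
    have 2: "\<bar>question_mark x + t - 2 * x\<bar> \<le> 2"
      using question_mark_unit[of x] x sub t by force
    have "(question_mark x - x)\<^sup>2 - (x - t)\<^sup>2 = (question_mark x - t) * (question_mark x + t - 2 * x)"
      by (simp add: power2_eq_square algebra_simps)
    then show "norm ((question_mark x - x)\<^sup>2 - (x - t)\<^sup>2) \<le> 2 / 2 ^ n"
      using mult_mono[OF 1 2] by (simp add: abs_mult)
  qed (simp add: integrable_const_ivl)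
  then show ?thesis
    using integral_diff[OF int has_integral_integrable[OF ftc]] integral_unique[OF ftc] pq
    by (simp add: diff_divide_distrib mult.commute)
qed

lemma integral_sb_pieces:
  fixes f :: "real \<Rightarrow> real"
  assumes "f integrable_on {0..1}" "m \<le> 2 ^ n"
  shows "integral {0..sb_pt n m} f = (\<Sum>j<m. integral {sb_pt n j..sb_pt n (Suc j)} f)"
  using assms(2)
proof (induction m)
  case 0
  then show ?case by (simp add: sb_pt_first)
next
  case (Suc m)
  have b: "0 \<le> sb_pt n m" "sb_pt n m \<le> sb_pt n (Suc m)" "sb_pt n (Suc m) \<le> 1"
    using sb_pt_bounds[of m n] sb_pt_bounds[of "Suc m" n] sb_pt_mono[of m "Suc m" n] Suc.prems by auto
  have "f integrable_on {0..sb_pt n (Suc m)}" 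
    by (rule integrable_on_subinterval[OF assms(1)]) (use b in auto)
  then have "integral {0..sb_pt n m} f + integral {sb_pt n m..sb_pt n (Suc m)} f = integral {0..sb_pt n (Suc m)} f"
    by (rule Henstock_Kurzweil_Integration.integral_combine[OF b(1,2)])
  then show ?case using Suc by simp
qed

text \<open>Summation by parts: if \<open>g\<close> is the deviation of a right endpoint from its own parameter,
  then its distance from the parameter of the left endpoint is \<open>g + 1/N\<close>. In the expansion
  of \<open>(g + 1/N)\<^sup>3\<close> the part \<open>g\<^sup>3\<close> telescopes to \<open>0\<close>, and the next one \<open>3 g\<^sup>2/N\<close> gives the sum of squares.\<close>

lemma cubic_telescope_deviation:
  "\<bar>(\<Sum>j<2 ^ n. ((sb_pt n (Suc j) - real j / 2 ^ n) ^ 3 - (sb_pt n j - real j / 2 ^ n) ^ 3) / 3)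
     - deviation n / 2 ^ n\<bar> \<le> 2 / 2 ^ n"
proof -
  define N :: real where "N = 2 ^ n"
  have N: "N \<ge> 1" by (simp add: N_def)
  define g where "g j = sb_pt n j - real j / N" for j
  have g: "\<bar>g j\<bar> \<le> 1" if "j \<le> 2 ^ n" for j
  proof -
    have "real j / N \<in> {0..1}" using that N by (simp add: N_def divide_simps)
    then show ?thesis using sb_pt_bounds[OF that] by (auto simp: g_def)
  qed
  have cube: "((sb_pt n (Suc j) - real j / 2 ^ n) ^ 3 - (sb_pt n j - real j / 2 ^ n) ^ 3) / 3
     = (g (Suc j) ^ 3 - g j ^ 3) / 3 + ((g (Suc j))\<^sup>2 / N + (g (Suc j) / N\<^sup>2 + 1 / (3 * N ^ 3)))" for j
  proof -
    have "sb_pt n (Suc j) - real j / 2 ^ n = g (Suc j) + 1 / N" "sb_pt n j - real j / 2 ^ n = g j"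
      by (auto simp: g_def N_def add_divide_distrib)
    moreover have "((x + 1 / N) ^ 3 - y ^ 3) / 3 = (x ^ 3 - y ^ 3) / 3 + (x\<^sup>2 / N + (x / N\<^sup>2 + 1 / (3 * N ^ 3)))" for x y
      using N by (simp add: power2_eq_square power3_eq_cube field_simps)
    ultimately show ?thesis by simp
  qed
  have tel: "(\<Sum>j<2 ^ n. (g (Suc j) ^ 3 - g j ^ 3) / 3) = 0"
    by (simp add: sum_divide_distrib[symmetric] sum_lessThan_telescope[of "\<lambda>j. g j ^ 3"])
       (simp add: g_def sb_pt_first sb_pt_last N_def)
  have sq: "(\<Sum>j<2 ^ n. (g (Suc j))\<^sup>2 / N) = deviation n / N"
    unfolding deviation_lessThan(2) sum_divide_distrib g_def N_def ..
  have "\<bar>\<Sum>j<2 ^ n. g (Suc j) / N\<^sup>2 + 1 / (3 * N ^ 3)\<bar> \<le> (\<Sum>j<(2::nat) ^ n. 2 / N\<^sup>2)"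
  proof (rule order_trans[OF sum_abs sum_mono])
    fix j assume "j \<in> {..<(2::nat) ^ n}"
    then have 1: "\<bar>g (Suc j) / N\<^sup>2\<bar> \<le> 1 / N\<^sup>2" using g[of "Suc j"] by (simp add: abs_divide divide_right_mono)
    have "N\<^sup>2 \<le> 3 * N ^ 3"
      using N by (simp add: power2_eq_square power3_eq_cube)
    then have 2: "\<bar>1 / (3 * N ^ 3)\<bar> \<le> 1 / N\<^sup>2" using N by (simp add: divide_simps)
    have two: "2 / N\<^sup>2 = 1 / N\<^sup>2 + 1 / N\<^sup>2" by simp
    show "\<bar>g (Suc j) / N\<^sup>2 + 1 / (3 * N ^ 3)\<bar> \<le> 2 / N\<^sup>2"
      unfolding two by (rule order_trans[OF abs_triangle_ineq add_mono[OF 1 2]])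
  qed
  also have "\<dots> = 2 / N" using N by (simp add: N_def power2_eq_square)
  finally have "\<bar>\<Sum>j<2 ^ n. g (Suc j) / N\<^sup>2 + 1 / (3 * N ^ 3)\<bar> \<le> 2 / N" .
  then show ?thesis unfolding cube sum.distrib[of _ "\<lambda>j. (g (Suc j))\<^sup>2 / N + (g (Suc j) / N\<^sup>2 + 1 / (3 * N ^ 3))"]
      sum.distrib[of "\<lambda>j. (g (Suc j))\<^sup>2 / N"] tel sq by (simp add: N_def)
qed

lemma deviation_integral_bounded:
  "\<bar>deviation n - 2 ^ n * integral {0..1} (\<lambda>x. (question_mark x - x)\<^sup>2)\<bar> \<le> 4"
proof -
  let ?f = "\<lambda>x. (question_mark x - x)\<^sup>2"
  let ?c = "\<lambda>j. ((sb_pt n (Suc j) - real j / 2 ^ n) ^ 3 - (sb_pt n j - real j / 2 ^ n) ^ 3) / 3"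
  have "integral {0..1} ?f = (\<Sum>j<2 ^ n. integral {sb_pt n j..sb_pt n (Suc j)} ?f)"
    using integral_sb_pieces[OF question_mark_integrable, of "2 ^ n" n] by (simp add: sb_pt_last)
  then have "\<bar>integral {0..1} ?f - (\<Sum>j<2 ^ n. ?c j)\<bar> =
      \<bar>\<Sum>j<2 ^ n. integral {sb_pt n j..sb_pt n (Suc j)} ?f - ?c j\<bar>"
    by (simp only: sum_subtractf)
  also have "\<dots> \<le> (\<Sum>j<2 ^ n. 2 / 2 ^ n * (sb_pt n (Suc j) - sb_pt n j))"
    by (rule order_trans[OF sum_abs sum_mono]) (use integral_question_mark_piece in auto)
  also have "\<dots> = 2 / 2 ^ n"
    unfolding sum_distrib_left[symmetric] by (simp add: sum_lessThan_telescope sb_pt_first sb_pt_last)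
  finally have "\<bar>integral {0..1} ?f - deviation n / 2 ^ n\<bar> \<le> 2 / 2 ^ n + 2 / 2 ^ n"
    using cubic_telescope_deviation[of n] by linarith
  then have "2 ^ n * \<bar>integral {0..1} ?f - deviation n / 2 ^ n\<bar> \<le> 2 ^ n * (2 / 2 ^ n + 2 / 2 ^ n)"
    by (intro mult_left_mono) auto
  also have "2 ^ n * \<bar>integral {0..1} ?f - deviation n / 2 ^ n\<bar> = \<bar>2 ^ n * (integral {0..1} ?f - deviation n / 2 ^ n)\<bar>"
    by (simp add: abs_mult)
  also have "\<dots> = \<bar>deviation n - 2 ^ n * integral {0..1} ?f\<bar>"
    by (simp add: right_diff_distrib abs_minus_commute)
  finally show ?thesis by (simp add: distrib_left)
qed

lemma deviation_asymptotics:
  "\<bar>deviation n - 2 ^ n * integral {0..1} (\<lambda>x. (question_mark x - x)\<^sup>2)\<bar> \<le> 400045 / (real n + 2)\<^sup>2"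
proof -
  define I where "I = integral {0..1} (\<lambda>x. (question_mark x - x)\<^sup>2)"
  have "\<bar>(deviation (Suc n) - 2 ^ Suc n * I) - 2 * (deviation n - 2 ^ n * I)\<bar> \<le> 400045 / (real n + 2)\<^sup>2" for n
    using deviation_doubling_defect[of n] by simp
  moreover have "antimono (\<lambda>n. 400045 / (real n + 2)\<^sup>2)"
    by (intro antimonoI divide_left_mono power_mono) auto
  moreover have "\<bar>deviation n - 2 ^ n * I\<bar> \<le> 4" for n
    unfolding I_def by (rule deviation_integral_bounded)
  ultimately have "\<bar>deviation n - 2 ^ n * I\<bar> \<le> 400045 / (real n + 2)\<^sup>2"
    by (rule bounded_doubling_recurrence[where e = "\<lambda>n. deviation n - 2 ^ n * I"])
  then show ?thesis by (simp only: I_def)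
qed

section \<open>The asymptotic formula\<close>

theorem theorem1:
  "(\<lambda>n::nat. (\<Sum>j = 1..2 ^ n. (real_of_rat (sb_elem n j) - real j / 2 ^ n)\<^sup>2)
      - 2 ^ n * integral {0..1} (\<lambda>x::real. (question_mark x - x)\<^sup>2))
   \<in> O(\<lambda>n. real n powr (- 3 / 2) * ln (real n) powr (- 1 / 2))"
proof (rule bigoI[of _ 400045])
  have eq: "(\<Sum>j = 1..2 ^ n. (real_of_rat (sb_elem n j) - real j / 2 ^ n)\<^sup>2) = deviation n" for n
    unfolding deviation_def by (intro sum.cong refl) (simp add: sb_elem_eq of_rat_sb_rat)
  show "\<forall>\<^sub>F n in sequentially. norm ((\<Sum>j = 1..2 ^ n. (real_of_rat (sb_elem n j) - real j / 2 ^ n)\<^sup>2)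
      - 2 ^ n * integral {0..1} (\<lambda>x::real. (question_mark x - x)\<^sup>2))
     \<le> 400045 * norm (real n powr (- 3 / 2) * ln (real n) powr (- 1 / 2))"
  proof (rule eventually_sequentiallyI[of 2])
    fix n :: nat assume n: "n \<ge> 2"
    have ln: "0 < ln (real n)" "ln (real n) \<le> real n" using n ln_le_minus_one[of "real n"] by auto
    have "1 / (real n + 2)\<^sup>2 \<le> 1 / (real n)\<^sup>2" using n by (intro divide_left_mono power_mono) auto
    also have "\<dots> = real n powr (- 2)" using n by (simp add: powr_minus_divide powr_numeral)
    also have "\<dots> = real n powr (- 3 / 2) * real n powr (- 1 / 2)" using n by (simp add: powr_add[symmetric])
    also have "\<dots> \<le> real n powr (- 3 / 2) * ln (real n) powr (- 1 / 2)"
      using ln by (intro mult_left_mono powr_mono2') auto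
    finally have "400045 / (real n + 2)\<^sup>2 \<le> 400045 * (real n powr (- 3 / 2) * ln (real n) powr (- 1 / 2))" by simp
    then show "norm ((\<Sum>j = 1..2 ^ n. (real_of_rat (sb_elem n j) - real j / 2 ^ n)\<^sup>2)
      - 2 ^ n * integral {0..1} (\<lambda>x::real. (question_mark x - x)\<^sup>2))
     \<le> 400045 * norm (real n powr (- 3 / 2) * ln (real n) powr (- 1 / 2))"
      unfolding eq using deviation_asymptotics[of n] by simp
  qed
qed

end
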